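(* Let $X_\iota$, $\iota\in I=\{1,2\}$, be positive random variables which are free with respect to $\varphi$ (realized as in the context), and denote $$t_\iota=1+x_\iota,\qquad T_{\bar\iota}=\sqrt{X_\iota-x_\iota}\;X_{\bar\iota}\,\sqrt{X_\iota-x_\iota}.$$ Then, for each $\iota\in I$, $X_{\bar\iota}X_\iota$ has the same $\varphi$-distribution as $\sqrt{t_\iota}\,T_{\bar\iota}\sqrt{t_\iota}$, and the pair $(t_\iota-1,\,T_{\bar\iota}-1)$ is monotone independent with respect to $\varphi$.
   Context: $I=\{1,2\}$, $\bar 1=2$, $\bar 2=1$. $(\mathcal H_\iota,\xi_\iota)$, $\iota\in I$, are Hilbert spaces with distinguished unit vectors, $\mathcal H_\iota^0=\mathcal H_\iota\ominus\mathbb C\xi_\iota$. Their free product is $(\mathcal H,\xi)$, $\mathcal H=\mathbb C\xi\oplus\bigoplus_{n\ge1}\bigoplus_{\iota_1\ne\iota_2\ne\dots\ne\iota_n}\mathcal H_{\iota_1}^0\otimes\dots\otimes\mathcal H_{\iota_n}^0$. For $n\ge1$, $\mathcal H^{(n)}(\iota)$ is the direct sum of those $\mathcal H_{\iota_1}^0\otimes\dots\otimes\mathcal H_{\iota_n}^0$ ($\iota_1\neq\dots\neq\iota_n$) with $\iota_1\ne\iota$; $\mathcal H^{(0)}(\iota)=\mathbb C\xi$. For each $\iota$, $\mathcal H=\bigoplus_{n\ge1}\big(\mathcal H^{(n-1)}(\iota)\oplus\mathcal H^{(n)}(\bar\iota)\big)$ and $P_\iota(n)$ is the orthogonal projection onto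 the $n$-th summand. $\lambda$ denotes the free product representation: $a\in B(\mathcal H_\iota)$ acts as $a\otimes1$ under the natural unitary $\mathcal H\cong\mathcal H_\iota\otimes\bigoplus_{n\ge0}\mathcal H^{(n)}(\iota)$. For fixed $x\in B(\mathcal H_1)$, $y\in B(\mathcal H_2)$ put $X_1=\lambda(x)$, $X_2=\lambda(y)$; these are free with respect to the vacuum state $\varphi(\cdot)=\langle\cdot\,\xi,\xi\rangle$ on $B(\mathcal H)$. Put $X_\iota(j)=P_\iota(j)X_\iota P_\iota(j)$ (so $X_\iota=\sum_jX_\iota(j)$ strongly), $x_\iota(j)=X_\iota(j)-P_\iota(j)$ and $x_\iota=x_\iota(1)$. The $\varphi$-distribution of $a$ is the functional $X^n\mapsto\varphi(a^n)$ on $\mathbb C[X]$. A pair $(a,b)$ is monotone independent w.r.t. $\varphi$ if, with $\mathcal A_1,\mathcal A_2$ the non-unital algebras generated by $a$ and by $b$, one has $\varphi(w_1a_1b')=\varphi(b')\varphi(w_1a_1)$, $\varphi(b'a_2w_2)=\varphi(b')\varphi(a_2w_2)$, $\varphi(w_1a_1b'a_2w_2)=\varphi(b')\varphi(w_1a_1a_2w_2)$ for all $a_1,a_2\in\mathcal A_1$, $b'\in\mathcal A_2$ and $w_1,w_2$ in the unital algebra generated by $\mathcal A_1,\mathcal A_2$. *)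

theory Defs
  imports
    "HOL-Analysis.Analysis"
    "HOL-Computational_Algebra.Polynomial"
    "HOL-Library.Function_Algebras"
begin

section \<open>Complex Hilbert spaces and their operators\<close>

text \<open>The inner product is linear in the first argument. Positive definiteness follows from
  \<open>norm_eq_sqrt_cinner\<close> and the norm axioms; completeness comes from \<^class>\<open>banach\<close>.\<close>

class complex_hilbert_space = banach +
  fixes scaleC :: "complex \<Rightarrow> 'a \<Rightarrow> 'a"  (infixr "*\<^sub>C" 75)
    and cinner :: "'a \<Rightarrow> 'a \<Rightarrow> complex"
  assumes scaleC_add_right: "c *\<^sub>C (u + v) = c *\<^sub>C u + c *\<^sub>C v"
    and scaleC_add_left: "(c + d) *\<^sub>C u = c *\<^sub>C u + d *\<^sub>C u"
    and scaleC_scaleC: "c *\<^sub>C (d *\<^sub>C u) = (c * d) *\<^sub>C u"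
    and scaleR_scaleC: "r *\<^sub>R u = complex_of_real r *\<^sub>C u"
    and cinner_add_left: "cinner (u + v) w = cinner u w + cinner v w"
    and cinner_scaleC_left: "cinner (c *\<^sub>C u) v = c * cinner u v"
    and cinner_commute: "cinner u v = cnj (cinner v u)"
    and norm_eq_sqrt_cinner: "norm u = sqrt (Re (cinner u u))"

global_interpretation complex_vector:
  vector_space "scaleC :: complex \<Rightarrow> 'a \<Rightarrow> 'a::complex_hilbert_space"
  defines cspan = complex_vector.span
proof
  show "1 *\<^sub>C u = u" for u :: 'a
    using scaleR_scaleC[of 1 u] by simp
qed (simp_all add: scaleC_add_right scaleC_add_left scaleC_scaleC)

definition bounded_clinear ::
    "('a::complex_hilbert_space \<Rightarrow> 'b::complex_hilbert_space) \<Rightarrow> bool" where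
  "bounded_clinear A \<longleftrightarrow> bounded_linear A \<and> (\<forall>c u. A (c *\<^sub>C u) = c *\<^sub>C A u)"

definition positive_op :: "('a::complex_hilbert_space \<Rightarrow> 'a) \<Rightarrow> bool" where
  "positive_op A \<longleftrightarrow> bounded_clinear A \<and> (\<forall>u. cinner (A u) u \<in> \<real>\<^sub>\<ge>\<^sub>0)"

definition op_sqrt :: "('a::complex_hilbert_space \<Rightarrow> 'a) \<Rightarrow> 'a \<Rightarrow> 'a" where
  "op_sqrt A = (THE B. positive_op B \<and> B \<circ> B = A)"

text \<open>Orthogonal projection; meaningful for closed subspaces \<open>S\<close>.\<close>

definition orth_proj :: "'a::complex_hilbert_space set \<Rightarrow> 'a \<Rightarrow> 'a" where
  "orth_proj S u = (THE p. p \<in> S \<and> (\<forall>s\<in>S. cinner (u - p) s = 0))"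

section \<open>The free product of two Hilbert spaces with distinguished unit vectors\<close>

datatype idx = I1 | I2

fun bar :: "idx \<Rightarrow> idx" where
  "bar I1 = I2"
| "bar I2 = I1"

text \<open>A letter \<open>Inl u\<close> is a vector of \<open>H\<^sub>1\<close>, a letter \<open>Inr u\<close> a vector of \<open>H\<^sub>2\<close>. The reduced
  word \<open>[l\<^sub>1, \<dots>, l\<^sub>n]\<close> stands for the simple tensor \<open>l\<^sub>1 \<otimes> \<dots> \<otimes> l\<^sub>n\<close>; the empty word stands
  for \<open>\<xi>\<close>.\<close>

fun letter_idx :: "'a + 'b \<Rightarrow> idx" where
  "letter_idx (Inl u) = I1"
| "letter_idx (Inr v) = I2"

fun letter_centered ::
    "'a::complex_hilbert_space \<Rightarrow> 'b::complex_hilbert_space \<Rightarrow> 'a + 'b \<Rightarrow> bool" where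
  "letter_centered \<xi>1 \<xi>2 (Inl u) \<longleftrightarrow> cinner u \<xi>1 = 0"
| "letter_centered \<xi>1 \<xi>2 (Inr v) \<longleftrightarrow> cinner v \<xi>2 = 0"

fun letter_inner ::
    "'a::complex_hilbert_space + 'b::complex_hilbert_space \<Rightarrow> 'a + 'b \<Rightarrow> complex" where
  "letter_inner (Inl u) (Inl u') = cinner u u'"
| "letter_inner (Inr v) (Inr v') = cinner v v'"
| "letter_inner _ _ = 0"

definition reduced_words ::
    "'a::complex_hilbert_space \<Rightarrow> 'b::complex_hilbert_space \<Rightarrow> ('a + 'b) list set" where
  "reduced_words \<xi>1 \<xi>2 =
    {w. (\<forall>l\<in>set w. letter_centered \<xi>1 \<xi>2 l) \<and>
        successively (\<lambda>k l. letter_idx k \<noteq> letter_idx l) w}"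

text \<open>\<open>is_free_product \<xi>1 \<xi>2 \<xi> tens\<close>: the ambient Hilbert space \<open>H\<close> with vector \<open>\<xi>\<close> is the free
  product, \<open>tens\<close> sending a reduced word to the simple tensor it stands for. The inner product
  formula is the one defining the Hilbert space tensor products and makes the summands for
  different index sequences orthogonal (a factor \<open>letter_inner\<close> then vanishes, or the lengths
  differ); the second condition says that \<open>H\<close> is the completed direct sum. Multilinearity of
  \<open>tens\<close> on reduced words follows from the inner product formula.\<close>

definition is_free_product ::
    "'a::complex_hilbert_space \<Rightarrow> 'b::complex_hilbert_space \<Rightarrow> 'h::complex_hilbert_space \<Rightarrow>
      (('a + 'b) list \<Rightarrow> 'h) \<Rightarrow> bool" where
  "is_free_product \<xi>1 \<xi>2 \<xi> tens \<longleftrightarrow>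
    (\<forall>u\<in>reduced_words \<xi>1 \<xi>2. \<forall>v\<in>reduced_words \<xi>1 \<xi>2.
      cinner (tens u) (tens v) =
        (if length u = length v then \<Prod>i<length u. letter_inner (u ! i) (v ! i) else 0)) \<and>
    closure (cspan (tens ` reduced_words \<xi>1 \<xi>2)) = UNIV \<and>
    tens [] = \<xi>"

text \<open>Reduced words not starting in \<open>H\<^sub>\<iota>\<close>, and the spaces \<open>H\<^bsup>(n)\<^esup>(\<iota>)\<close>.\<close>

definition words_avoiding ::
    "'a::complex_hilbert_space \<Rightarrow> 'b::complex_hilbert_space \<Rightarrow> idx \<Rightarrow> ('a + 'b) list set" where
  "words_avoiding \<xi>1 \<xi>2 \<iota> =
    {w \<in> reduced_words \<xi>1 \<xi>2. w \<noteq> [] \<longrightarrow> letter_idx (hd w) \<noteq> \<iota>}"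

definition word_space ::
    "'a::complex_hilbert_space \<Rightarrow> 'b::complex_hilbert_space \<Rightarrow>
      (('a + 'b) list \<Rightarrow> 'h::complex_hilbert_space) \<Rightarrow> nat \<Rightarrow> idx \<Rightarrow> 'h set" where
  "word_space \<xi>1 \<xi>2 tens n \<iota> =
    closure (cspan (tens ` {w \<in> words_avoiding \<xi>1 \<xi>2 \<iota>. length w = n}))"

text \<open>\<open>P\<^sub>\<iota>(n)\<close>, for \<open>n \<ge> 1\<close>.\<close>

definition level_proj ::
    "'a::complex_hilbert_space \<Rightarrow> 'b::complex_hilbert_space \<Rightarrow>
      (('a + 'b) list \<Rightarrow> 'h::complex_hilbert_space) \<Rightarrow> idx \<Rightarrow> nat \<Rightarrow> 'h \<Rightarrow> 'h" where
  "level_proj \<xi>1 \<xi>2 tens \<iota> n =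
    orth_proj {u + v |u v. u \<in> word_space \<xi>1 \<xi>2 tens (n - 1) \<iota> \<and>
                           v \<in> word_space \<xi>1 \<xi>2 tens n (bar \<iota>)}"

section \<open>The free product representation\<close>

text \<open>The image of \<open>v \<otimes> w\<close> under the natural unitary from the tensor product of \<open>H\<^sub>\<iota>\<close> and the
  direct sum of all \<open>H\<^bsup>(n)\<^esup>(\<iota>)\<close> onto \<open>H\<close>, for \<open>v\<close> in \<open>H\<^sub>\<iota>\<close> and a word \<open>w\<close> avoiding \<open>\<iota>\<close>:
  \<open>v\<close> is split into its component along the distinguished vector, which is absorbed, and its
  centered part, which becomes the first letter.\<close>

fun attach ::
    "'a::complex_hilbert_space \<Rightarrow> 'b::complex_hilbert_space \<Rightarrow>
      (('a + 'b) list \<Rightarrow> 'h::complex_hilbert_space) \<Rightarrow> 'a + 'b \<Rightarrow> ('a + 'b) list \<Rightarrow> 'h" where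
  "attach \<xi>1 \<xi>2 tens (Inl u) w =
    cinner u \<xi>1 *\<^sub>C tens w + tens (Inl (u - cinner u \<xi>1 *\<^sub>C \<xi>1) # w)"
| "attach \<xi>1 \<xi>2 tens (Inr v) w =
    cinner v \<xi>2 *\<^sub>C tens w + tens (Inr (v - cinner v \<xi>2 *\<^sub>C \<xi>2) # w)"

text \<open>\<open>\<lambda>(a) = a \<otimes> 1\<close>, for \<open>a\<close> in \<open>B(H\<^sub>1)\<close> and in \<open>B(H\<^sub>2)\<close> respectively.\<close>

definition free_rep1 ::
    "'a::complex_hilbert_space \<Rightarrow> 'b::complex_hilbert_space \<Rightarrow>
      (('a + 'b) list \<Rightarrow> 'h::complex_hilbert_space) \<Rightarrow> ('a \<Rightarrow> 'a) \<Rightarrow> 'h \<Rightarrow> 'h" where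
  "free_rep1 \<xi>1 \<xi>2 tens a =
    (THE A. bounded_clinear A \<and>
      (\<forall>u. \<forall>w\<in>words_avoiding \<xi>1 \<xi>2 I1.
        A (attach \<xi>1 \<xi>2 tens (Inl u) w) = attach \<xi>1 \<xi>2 tens (Inl (a u)) w))"

definition free_rep2 ::
    "'a::complex_hilbert_space \<Rightarrow> 'b::complex_hilbert_space \<Rightarrow>
      (('a + 'b) list \<Rightarrow> 'h::complex_hilbert_space) \<Rightarrow> ('b \<Rightarrow> 'b) \<Rightarrow> 'h \<Rightarrow> 'h" where
  "free_rep2 \<xi>1 \<xi>2 tens a =
    (THE A. bounded_clinear A \<and>
      (\<forall>v. \<forall>w\<in>words_avoiding \<xi>1 \<xi>2 I2.
        A (attach \<xi>1 \<xi>2 tens (Inr v) w) = attach \<xi>1 \<xi>2 tens (Inr (a v)) w))"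

section \<open>Distributions and monotone independence\<close>

definition vacuum_state :: "'h::complex_hilbert_space \<Rightarrow> ('h \<Rightarrow> 'h) \<Rightarrow> complex" where
  "vacuum_state \<xi> A = cinner (A \<xi>) \<xi>"

definition distribution :: "(('h \<Rightarrow> 'h) \<Rightarrow> complex) \<Rightarrow> ('h \<Rightarrow> 'h) \<Rightarrow> complex poly \<Rightarrow> complex" where
  "distribution \<phi> A p = (\<Sum>n\<le>degree p. coeff p n * \<phi> (A ^^ n))"

text \<open>The non-unital algebra generated by \<open>S\<close>, under composition of operators; the unital one is
  obtained by adding \<^const>\<open>id\<close> to \<open>S\<close>.\<close>

inductive_set generated_algebra ::
    "('h::complex_hilbert_space \<Rightarrow> 'h) set \<Rightarrow> ('h \<Rightarrow> 'h) set" for S where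
  generator: "A \<in> S \<Longrightarrow> A \<in> generated_algebra S"
| scale: "A \<in> generated_algebra S \<Longrightarrow> (\<lambda>u. c *\<^sub>C A u) \<in> generated_algebra S"
| add: "A \<in> generated_algebra S \<Longrightarrow> B \<in> generated_algebra S \<Longrightarrow> A + B \<in> generated_algebra S"
| comp: "A \<in> generated_algebra S \<Longrightarrow> B \<in> generated_algebra S \<Longrightarrow> A \<circ> B \<in> generated_algebra S"

definition monotone_independent ::
    "(('h::complex_hilbert_space \<Rightarrow> 'h) \<Rightarrow> complex) \<Rightarrow> ('h \<Rightarrow> 'h) \<Rightarrow> ('h \<Rightarrow> 'h) \<Rightarrow> bool" where
  "monotone_independent \<phi> a b \<longleftrightarrow>
    (let A1 = generated_algebra {a};
         A2 = generated_algebra {b};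
         W = generated_algebra ({id} \<union> A1 \<union> A2)
     in \<forall>a1\<in>A1. \<forall>a2\<in>A1. \<forall>b'\<in>A2. \<forall>w1\<in>W. \<forall>w2\<in>W.
          \<phi> (w1 \<circ> a1 \<circ> b') = \<phi> b' * \<phi> (w1 \<circ> a1) \<and>
          \<phi> (b' \<circ> a2 \<circ> w2) = \<phi> b' * \<phi> (a2 \<circ> w2) \<and>
          \<phi> (w1 \<circ> a1 \<circ> b' \<circ> a2 \<circ> w2) = \<phi> b' * \<phi> (w1 \<circ> a1 \<circ> a2 \<circ> w2))"

end

theory Submission
  imports Defs
begin

text \<open>Write \<open>X = X\<^sub>\<iota>\<close>, \<open>Y = X\<^bsub>\<iota>'\<^esub>\<close> with \<open>\<iota>'\<close> the other index, \<open>P = P\<^sub>\<iota>(1)\<close>, \<open>t = t\<^sub>\<iota>\<close> and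
  \<open>s = X - x\<^sub>\<iota>\<close>. As \<open>P\<close> commutes with \<open>X\<close>, so do \<open>t = XP + (1 - P)\<close> and \<open>s = X(1 - P) + P\<close>, and
  \<open>t s = X\<close>; hence \<open>\<surd>t \<surd>s = \<surd>X\<close> and \<open>\<surd>t T \<surd>t = \<surd>X Y \<surd>X\<close>. The moments of this operator are those
  of \<open>Y X\<close> because \<open>\<phi>\<close> is a trace on the algebra generated by the free variables \<open>X\<close> and \<open>Y\<close>: expand
  in alternating products of centered elements, all of which \<open>\<phi>\<close> annihilates.

  The range of \<open>P\<close> is spanned by \<open>\<xi>\<close> and the one-letter words \<open>k\<close> of index \<open>\<iota>\<close>. Both \<open>Y\<close> and \<open>s\<close>
  commute with the right tensoring \<open>w \<mapsto> w \<otimes> k\<close> of words not ending with index \<open>\<iota>\<close>, so every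
  \<open>B\<close> in the algebra they generate satisfies \<open>P B P = \<phi>(B) P\<close>. Since \<open>\<surd>s P = P\<close>, the same holds for
  the algebra generated by \<open>T - 1 = \<surd>s Y \<surd>s - 1\<close>. Together with \<open>t - 1 = P (t - 1) P\<close> this is
  monotone independence.\<close>

section \<open>Complex Hilbert spaces\<close>

text \<open>The correction \<open>s\<close> is forced by right tensoring. In general
  \<open>X\<^sub>\<iota>\<close> fails to commute with \<open>w \<mapsto> w \<otimes> k\<close>, but
  only at the empty word, where it acts on \<open>k\<close> as a first letter instead of on the
  vacuum; subtracting \<open>x\<^sub>\<iota>\<close> turns it into the identity on exactly these
  vectors. Right tensoring is handled as a relation on algebraic spans of words, and strong limits
  may leave such spans. Hence \<open>\<surd>s\<close>, obtained as a strong limit, is never claimed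
  to respect it: elements of the algebra of \<open>T - 1\<close> are kept in the form
  \<open>\<surd>s B \<surd>s + c\<close>, and products of them produce only \<open>s\<close>. Square
  roots, the projection \<open>P\<close> and the representation are given by definite descriptions,
  so existence and uniqueness have to be established. Each root is built as a strong limit of
  polynomials in its operator; this one fact gives its uniqueness, its commutation with other
  operators, and the passage of the trace property to \<open>\<surd>X\<close>. The free product is
  known only through inner products of words, so linearity and boundedness of tensor constructions
  are derived from Gram sums.\<close>

lemma cinner_scaleC_right: "cinner u (c *\<^sub>C v) = cnj c * cinner u v"
  by (subst (1 2) cinner_commute) (simp add: cinner_scaleC_left)

lemma cinner_add_right: "cinner u (v + w) = cinner u v + cinner u w"
  by (subst (1 2 3) cinner_commute) (simp add: cinner_add_left)

lemma cinner_zero_left [simp]: "cinner 0 u = 0"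
  using cinner_scaleC_left[of 0 0 u] by simp

lemma cinner_zero_right [simp]: "cinner u 0 = 0"
  by (subst cinner_commute) simp

lemma cinner_minus_left: "cinner (- u) v = - cinner u v"
  using cinner_scaleC_left[of "- 1" u v] by simp

lemma cinner_minus_right: "cinner u (- v) = - cinner u v"
  by (subst (1 2) cinner_commute) (simp add: cinner_minus_left)

lemma cinner_diff_left: "cinner (u - v) w = cinner u w - cinner v w"
  using cinner_add_left[of u "- v" w] by (simp add: cinner_minus_left)

lemma cinner_diff_right: "cinner u (v - w) = cinner u v - cinner u w"
  using cinner_add_right[of u v "- w"] by (simp add: cinner_minus_right)

lemmas cinner_simps = cinner_add_left cinner_add_right cinner_diff_left cinner_diff_right
  cinner_minus_left cinner_minus_right cinner_scaleC_left cinner_scaleC_right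

lemma cinner_sum_left: "cinner (\<Sum>i\<in>I. f i) v = (\<Sum>i\<in>I. cinner (f i) v)"
  by (induction I rule: infinite_finite_induct) (auto simp: cinner_add_left)

lemma cinner_sum_right: "cinner v (\<Sum>i\<in>I. f i) = (\<Sum>i\<in>I. cinner v (f i))"
  by (induction I rule: infinite_finite_induct) (auto simp: cinner_add_right)

lemma cinner_self: "cinner u u = complex_of_real ((norm u)\<^sup>2)"
proof (rule complex_eqI)
  have "Re (cinner u u) \<ge> 0"
    by (metis norm_eq_sqrt_cinner norm_ge_zero real_sqrt_ge_0_iff)
  then show "Re (cinner u u) = Re (complex_of_real ((norm u)\<^sup>2))"
    by (simp add: norm_eq_sqrt_cinner)
  have "Im (cinner u u) = - Im (cinner u u)"
    using cinner_commute[of u u] by (metis complex_cnj cnj.simps(2))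
  then show "Im (cinner u u) = Im (complex_of_real ((norm u)\<^sup>2))"
    by simp
qed

lemma cinner_self_eq_0 [simp]: "cinner u u = 0 \<longleftrightarrow> u = 0"
  by (simp add: cinner_self)

lemma norm_scaleC: "norm (c *\<^sub>C u) = cmod c * norm u"
proof -
  have "complex_of_real ((norm (c *\<^sub>C u))\<^sup>2) = complex_of_real ((cmod c * norm u)\<^sup>2)"
    unfolding cinner_self[symmetric] cinner_scaleC_left cinner_scaleC_right
    using complex_norm_square[of c] by (simp add: cinner_self power_mult_distrib mult.commute)
  then have "(norm (c *\<^sub>C u))\<^sup>2 = (cmod c * norm u)\<^sup>2"
    using of_real_eq_iff by blast
  then show ?thesis
    by (simp add: power2_eq_iff_nonneg)
qed

text \<open>The form is only semidefinite, so that one proof serves both the inner product and the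
  form \<open>cinner (A u) v\<close> of a positive operator. The source is a real quadratic in
  \<open>r\<close> that is never negative.\<close>

lemma hermitian_form_Cauchy_Schwarz:
  fixes A :: "'a::complex_hilbert_space \<Rightarrow> 'a"
  assumes add: "\<And>u v. A (u + v) = A u + A v" and scale: "\<And>c u. A (c *\<^sub>C u) = c *\<^sub>C A u"
    and sym: "\<And>u v. cinner (A u) v = cinner u (A v)"
    and pos: "\<And>u. Re (cinner (A u) u) \<ge> 0"
  shows "(cmod (cinner (A u) v))\<^sup>2 \<le> Re (cinner (A u) u) * Re (cinner (A v) v)"
proof -
  define z where "z = cinner (A u) v"
  define a b m where "a = Re (cinner (A u) u)" and "b = Re (cinner (A v) v)" and "m = (cmod z)\<^sup>2"
  have vu: "cinner (A v) u = cnj z"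
    unfolding z_def using cinner_commute[of "A u" v] sym[of v u] by simp
  have im: "z * cnj z = complex_of_real m"
    by (metis complex_norm_square m_def of_real_power)
  have quad: "0 \<le> a + 2 * r * m + r\<^sup>2 * m * b" for r
  proof -
    \<comment> \<open>The coefficient \<open>z = cinner (A u) v\<close> rotates the phase: both
      cross terms become \<open>r\<close> times the squared modulus of \<open>z\<close>, leaving a
      real quadratic in \<open>r\<close>.\<close>
    let ?w = "u + (of_real r * z) *\<^sub>C v"
    have "cinner (A ?w) ?w = cinner (A u) u + of_real r * (z * cnj z) + of_real r * (z * cnj z)
        + of_real r * of_real r * (z * cnj z) * cinner (A v) v"
      by (simp add: add scale cinner_simps vu z_def[symmetric] algebra_simps)
    then have "Re (cinner (A ?w) ?w) = a + 2 * r * m + r\<^sup>2 * m * b"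
      unfolding im by (simp add: a_def b_def power2_eq_square)
    then show ?thesis
      using pos[of ?w] by simp
  qed
  have a0: "a \<ge> 0" and b0: "b \<ge> 0" and m0: "m \<ge> 0"
    using pos by (auto simp: a_def b_def m_def)
  have "m \<le> a * b"
  \<comment> \<open>If \<open>b = 0\<close>, the quadratic is affine in \<open>r\<close>, and for
    \<open>m > 0\<close> the chosen \<open>r\<close> gives it the value -1. Otherwise
    \<open>r = - 1 / b\<close> is its minimizer, with value \<open>a - m / b\<close>.\<close>
  proof (cases "b = 0")
    case True
    show ?thesis
    proof (rule ccontr)
      assume "\<not> m \<le> a * b"
      then have "m > 0" using True by simp
      then show False
        using quad[of "- (a + 1) / (2 * m)"] True by (simp add: field_simps)
    qed
  next
    case False
    then show ?thesis
      using quad[of "- 1 / b"] b0 by (simp add: field_simps power2_eq_square)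
  qed
  then show ?thesis
    by (simp add: m_def z_def a_def b_def)
qed

lemma cinner_Cauchy_Schwarz: "cmod (cinner u v) \<le> norm u * norm v"
proof -
  have "(cmod (cinner u v))\<^sup>2 \<le> Re (cinner u u) * Re (cinner v v)"
    using hermitian_form_Cauchy_Schwarz[of "\<lambda>u. u" u v] by (simp add: cinner_self)
  then have "(cmod (cinner u v))\<^sup>2 \<le> (norm u * norm v)\<^sup>2"
    by (simp add: cinner_self power_mult_distrib)
  then show ?thesis
    by (simp add: power2_le_iff_abs_le)
qed

lemma bounded_bilinear_cinner: "bounded_bilinear cinner"
  by (unfold_locales)
    (auto simp: cinner_simps scaleR_scaleC scaleR_conv_of_real intro!: exI[of _ 1] cinner_Cauchy_Schwarz)

lemma bounded_linear_scaleC_right: "bounded_linear (\<lambda>u. c *\<^sub>C u)"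
  by (rule bounded_linear_intro[of _ "cmod c"])
    (auto simp: scaleC_add_right scaleR_scaleC scaleC_scaleC norm_scaleC mult.commute)

lemmas tendsto_cinner [tendsto_intros] = bounded_bilinear.tendsto[OF bounded_bilinear_cinner]
lemmas tendsto_scaleC [tendsto_intros] = bounded_linear.tendsto[OF bounded_linear_scaleC_right]

lemma closed_cinner_eq_0: "closed {u. cinner u v = 0}"
  by (intro closed_Collect_eq continuous_on_const linear_continuous_on
      bounded_bilinear.bounded_linear_left bounded_bilinear_cinner)

section \<open>Bounded operators and the algebras they generate\<close>

lemma bounded_clinear_bounded_linear: "bounded_clinear A \<Longrightarrow> bounded_linear A"
  by (simp add: bounded_clinear_def)

lemma bounded_clinear_scaleC: "bounded_clinear A \<Longrightarrow> A (c *\<^sub>C u) = c *\<^sub>C A u"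
  by (simp add: bounded_clinear_def)

lemma bounded_clinear_add: "bounded_clinear A \<Longrightarrow> A (u + v) = A u + A v"
  by (simp add: bounded_clinear_def linear_simps)

lemma bounded_clinear_diff: "bounded_clinear A \<Longrightarrow> A (u - v) = A u - A v"
  by (simp add: bounded_clinear_def linear_simps)

lemma bounded_clinear_zero: "bounded_clinear A \<Longrightarrow> A 0 = 0"
  by (simp add: bounded_clinear_def linear_simps)

lemmas bounded_clinear_simps =
  bounded_clinear_scaleC bounded_clinear_add bounded_clinear_diff bounded_clinear_zero

lemma bounded_clinearI:
  assumes "\<And>u v. A (u + v) = A u + A v" "\<And>c u. A (c *\<^sub>C u) = c *\<^sub>C A u"
    and "\<And>u. norm (A u) \<le> norm u * M"
  shows "bounded_clinear A"
  unfolding bounded_clinear_def using assms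
  by (auto simp: scaleR_scaleC intro!: bounded_linear_intro[of A M])

lemma bounded_clinear_ident: "bounded_clinear id"
  by (rule bounded_clinearI[of _ 1]) auto

lemma bounded_clinear_plus: "bounded_clinear A \<Longrightarrow> bounded_clinear B \<Longrightarrow> bounded_clinear (A + B)"
  by (auto simp: bounded_clinear_def plus_fun_def scaleC_add_right intro: bounded_linear_add)

lemma bounded_clinear_minus: "bounded_clinear A \<Longrightarrow> bounded_clinear B \<Longrightarrow> bounded_clinear (A - B)"
  by (auto simp: bounded_clinear_def fun_diff_def complex_vector.scale_right_diff_distrib
      intro: bounded_linear_sub)

lemma bounded_clinear_scale: "bounded_clinear A \<Longrightarrow> bounded_clinear (\<lambda>u. c *\<^sub>C A u)"
  by (auto simp: bounded_clinear_def scaleC_scaleC mult.commute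
      intro: bounded_linear_compose[OF bounded_linear_scaleC_right])

lemma bounded_clinear_comp: "bounded_clinear A \<Longrightarrow> bounded_clinear B \<Longrightarrow> bounded_clinear (A \<circ> B)"
  by (auto simp: bounded_clinear_def o_def intro: bounded_linear_compose)

lemma bounded_clinear_tendsto:
  "bounded_clinear A \<Longrightarrow> (f \<longlongrightarrow> l) F \<Longrightarrow> ((\<lambda>i. A (f i)) \<longlongrightarrow> A l) F"
  by (auto simp: bounded_clinear_def intro: bounded_linear.tendsto)

lemma bounded_clinear_eqI:
  fixes A B :: "'a::complex_hilbert_space \<Rightarrow> 'b::complex_hilbert_space"
  assumes A: "bounded_clinear A" and B: "bounded_clinear B"
    and dense: "closure (cspan S) = UNIV" and eq: "\<And>u. u \<in> S \<Longrightarrow> A u = B u"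
  shows "A = B"
proof
  fix u
  have span: "A v = B v" if "v \<in> cspan S" for v
    using that
    by (induction rule: complex_vector.span_induct_alt)
      (auto simp: bounded_clinear_simps[OF A] bounded_clinear_simps[OF B] eq)
  obtain f where f: "\<And>n. f n \<in> cspan S" "f \<longlonglongrightarrow> u"
    using dense closure_sequential by blast
  have "(\<lambda>n. A (f n)) \<longlonglongrightarrow> A u" "(\<lambda>n. A (f n)) \<longlonglongrightarrow> B u"
    using bounded_clinear_tendsto[OF A f(2)] bounded_clinear_tendsto[OF B f(2)] span[OF f(1)] by simp_all
  then show "A u = B u"
    by (rule LIMSEQ_unique)
qed

lemma generated_algebra_bounded_clinear:
  assumes "\<And>A. A \<in> S \<Longrightarrow> bounded_clinear A" "A \<in> generated_algebra S"
  shows "bounded_clinear A"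
  using assms(2)
  by induction (blast intro: assms(1) bounded_clinear_plus bounded_clinear_scale bounded_clinear_comp)+

lemma generated_algebra_commute:
  assumes B: "bounded_clinear B" and gen: "\<And>A u. A \<in> S \<Longrightarrow> A (B u) = B (A u)"
    and A: "A \<in> generated_algebra S"
  shows "A (B u) = B (A u)"
  using A by (induction arbitrary: u) (auto simp: gen bounded_clinear_simps[OF B])

section \<open>Positive operators\<close>

lemma positive_op_bounded_clinear: "positive_op A \<Longrightarrow> bounded_clinear A"
  by (simp add: positive_op_def)

lemma positive_op_Re: "positive_op A \<Longrightarrow> Re (cinner (A u) u) \<ge> 0"
  by (auto simp: positive_op_def complex_nonneg_Reals_iff)

text \<open>Polarization: the defect \<open>D\<close> is sesquilinear and vanishes on the diagonal,
  since the quadratic form is real. Evaluating it at \<open>u + v\<close> and at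
  \<open>u + \<i> v\<close> gives two relations between \<open>D u v\<close> and
  \<open>D v u\<close> that force both to be 0; this is where complex scalars matter.\<close>

lemma positive_op_symmetric:
  assumes "positive_op A"
  shows "cinner (A u) v = cinner u (A v)"
proof -
  note A = bounded_clinear_simps[OF positive_op_bounded_clinear[OF assms]]
  define D where "D = (\<lambda>u v. cinner (A u) v - cinner u (A v))"
  have 0: "D w w = 0" for w
  proof -
    have "Im (cinner (A w) w) = 0"
      using assms by (auto simp: positive_op_def complex_nonneg_Reals_iff)
    moreover have "cinner w (A w) = cnj (cinner (A w) w)"
      by (rule cinner_commute)
    ultimately show ?thesis
      unfolding D_def by (simp add: complex_eq_iff)
  qed
  have e1: "D u v + D v u = 0"
    using 0[of "u + v"] 0[of u] 0[of v] by (simp add: D_def A cinner_simps algebra_simps)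
  have "\<i> * (D v u - D u v) = 0"
    using 0[of "u + \<i> *\<^sub>C v"] 0[of u] 0[of v] by (simp add: D_def A cinner_simps algebra_simps)
  then have e2: "D v u = D u v" by simp
  show ?thesis
    using e1 e2 by (simp add: D_def)
qed

lemma positive_opI:
  assumes "bounded_clinear A" "\<And>u v. cinner (A u) v = cinner u (A v)" "\<And>u. Re (cinner (A u) u) \<ge> 0"
  shows "positive_op A"
proof -
  have "Im (cinner (A u) u) = 0" for u
    using assms(2)[of u u] cinner_commute[of "A u" u] by (simp add: complex_eq_iff)
  then show ?thesis
    using assms by (auto simp: positive_op_def complex_nonneg_Reals_iff)
qed

lemma positive_op_Cauchy_Schwarz:
  assumes "positive_op A"
  shows "(cmod (cinner (A u) v))\<^sup>2 \<le> Re (cinner (A u) u) * Re (cinner (A v) v)"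
  using assms
  by (intro hermitian_form_Cauchy_Schwarz)
    (simp_all add: bounded_clinear_simps positive_op_bounded_clinear positive_op_Re,
      rule positive_op_symmetric)

text \<open>Cauchy-Schwarz for the form of \<open>A\<close>, applied to \<open>u\<close> and
  \<open>A u\<close>, bounds the fourth power of the norm of \<open>A u\<close> by a multiple of
  \<open>cinner (A u) u\<close>.\<close>

lemma positive_op_kernel:
  assumes "positive_op A" "Re (cinner (A u) u) \<le> 0"
  shows "A u = 0"
proof -
  have "(cmod (cinner (A u) (A u)))\<^sup>2 \<le> 0"
    using positive_op_Cauchy_Schwarz[OF assms(1), of u "A u"] assms(2)
      positive_op_Re[OF assms(1)] by (smt (verit) mult_nonpos_nonneg)
  then show ?thesis
    by simp
qed

text \<open>A bound on the quadratic form becomes one on the norm through the same pair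
  \<open>u\<close>, \<open>A u\<close> in Cauchy-Schwarz: the factor belonging to \<open>A u\<close>
  is bounded by the hypothesis again, and the squared norm of \<open>A u\<close> cancels.\<close>

lemma positive_contraction_norm:
  assumes "positive_op A" "\<And>u. Re (cinner (A u) u) \<le> (norm u)\<^sup>2"
  shows "norm (A u) \<le> norm u"
proof (cases "A u = 0")
  case False
  have "((norm (A u))\<^sup>2)\<^sup>2 = (cmod (cinner (A u) (A u)))\<^sup>2"
    by (simp add: cinner_self norm_power)
  also have "\<dots> \<le> Re (cinner (A u) u) * Re (cinner (A (A u)) (A u))"
    by (rule positive_op_Cauchy_Schwarz[OF assms(1)])
  also have "\<dots> \<le> (norm u)\<^sup>2 * (norm (A u))\<^sup>2"
    by (intro mult_mono assms positive_op_Re[OF assms(1)]) auto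
  finally have "(norm (A u))\<^sup>2 \<le> (norm u)\<^sup>2"
    using False by (simp add: power2_eq_square)
  then show ?thesis
    by simp
qed auto

text \<open>Since the roots commute, \<open>B + C\<close> kills \<open>v = (B - C) u\<close>. Both
  forms are nonnegative at \<open>v\<close> and sum to 0, so \<open>B v = C v = 0\<close>, and
  moving \<open>B - C\<close> across the inner product gives \<open>cinner v v = 0\<close>.\<close>

lemma positive_op_square_root_unique:
  assumes B: "positive_op B" and C: "positive_op C"
    and comm: "\<And>u. B (C u) = C (B u)" and sq: "\<And>u. B (B u) = C (C u)"
  shows "B = C"
proof
  fix u
  note lin = bounded_clinear_simps[OF positive_op_bounded_clinear[OF B]]
    bounded_clinear_simps[OF positive_op_bounded_clinear[OF C]]
  define v where "v = B u - C u"
  have "B v + C v = 0"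
    by (simp add: v_def lin comm sq)
  then have "Re (cinner (B v) v) + Re (cinner (C v) v) = 0"
    by (metis cinner_add_left cinner_zero_left plus_complex.simps(1) zero_complex.simps(1))
  then have "Re (cinner (B v) v) \<le> 0" "Re (cinner (C v) v) \<le> 0"
    using positive_op_Re[OF B, of v] positive_op_Re[OF C, of v] by simp_all
  then have "B v = 0" "C v = 0"
    using positive_op_kernel[OF B] positive_op_kernel[OF C] by simp_all
  then have "cinner v v = 0"
    using positive_op_symmetric[OF B, of u v] positive_op_symmetric[OF C, of u v]
    by (subst (1) v_def) (simp add: cinner_simps)
  then show "B u = C u"
    by (simp add: v_def)
qed

section \<open>Square roots of positive operators\<close>

text \<open>The positive square root of \<open>A\<close> with \<open>0 \<le> A \<le> 1\<close> is \<open>1 - Z\<close>, where \<open>Z\<close> is the limit of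
  \<open>Z\<^sub>0 = 0\<close>, \<open>Z\<^sub>n\<^sub>+\<^sub>1 = (C + Z\<^sub>n\<^sup>2) / 2\<close> for \<open>C = 1 - A\<close>. The scalar iteration with \<open>C\<close> replaced
  by \<open>1\<close> dominates the operator norms of the differences, so convergence reduces to that of a
  bounded monotone sequence of reals.\<close>

primrec sqrt_iter_real :: "nat \<Rightarrow> real" where
  "sqrt_iter_real 0 = 0"
| "sqrt_iter_real (Suc n) = (1 + (sqrt_iter_real n)\<^sup>2) / 2"

primrec sqrt_iter :: "('h::complex_hilbert_space \<Rightarrow> 'h) \<Rightarrow> nat \<Rightarrow> 'h \<Rightarrow> 'h" where
  "sqrt_iter C 0 = (\<lambda>u. 0)"
| "sqrt_iter C (Suc n) = (\<lambda>u. (1 / 2) *\<^sub>C (C u + sqrt_iter C n (sqrt_iter C n u)))"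

lemma sqrt_iter_real_bounds: "0 \<le> sqrt_iter_real n \<and> sqrt_iter_real n \<le> 1"
proof (induction n)
  case (Suc n)
  then have "(sqrt_iter_real n)\<^sup>2 \<le> 1" by (simp add: power_le_one)
  then show ?case by simp
qed simp

lemma sqrt_iter_real_Suc_diff:
  "sqrt_iter_real (Suc (Suc n)) - sqrt_iter_real (Suc n) =
    (sqrt_iter_real (Suc n) + sqrt_iter_real n) * (sqrt_iter_real (Suc n) - sqrt_iter_real n) / 2"
  by (simp only: sqrt_iter_real.simps(2)[of "Suc n"] sqrt_iter_real.simps(2)[of n])
    (simp add: power2_eq_square field_simps)

lemma incseq_sqrt_iter_real: "incseq sqrt_iter_real"
proof (rule incseq_SucI)
  show "sqrt_iter_real n \<le> sqrt_iter_real (Suc n)" for n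
  proof (induction n)
    case (Suc n)
    have "0 \<le> (sqrt_iter_real (Suc n) + sqrt_iter_real n) *
        (sqrt_iter_real (Suc n) - sqrt_iter_real n) / 2"
      using Suc sqrt_iter_real_bounds[of n] sqrt_iter_real_bounds[of "Suc n"]
      by (intro divide_nonneg_nonneg mult_nonneg_nonneg) (simp_all del: sqrt_iter_real.simps)
    then show ?case
      unfolding sqrt_iter_real_Suc_diff[symmetric] by (simp del: sqrt_iter_real.simps)
  qed simp
qed

context
  fixes C :: "'h::complex_hilbert_space \<Rightarrow> 'h"
  assumes C: "bounded_clinear C" and contr: "\<And>u. norm (C u) \<le> norm u"
begin

lemma sqrt_iter_bounded_clinear: "bounded_clinear (sqrt_iter C n)"
proof (induction n)
  case 0
  show ?case by (rule bounded_clinearI[of _ 0]) auto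
next
  case (Suc n)
  have "sqrt_iter C (Suc n) = (\<lambda>u. (1 / 2) *\<^sub>C (C + (sqrt_iter C n \<circ> sqrt_iter C n)) u)"
    by (auto simp: fun_eq_iff)
  then show ?case
    using Suc C by (metis bounded_clinear_scale bounded_clinear_plus bounded_clinear_comp)
qed

lemma sqrt_iter_commute_base:
  assumes B: "bounded_clinear B" and "\<And>u. C (B u) = B (C u)"
  shows "sqrt_iter C n (B u) = B (sqrt_iter C n u)"
  by (induction n arbitrary: u) (simp_all add: bounded_clinear_simps[OF B] assms(2))

lemma sqrt_iter_commute: "sqrt_iter C n (sqrt_iter C m u) = sqrt_iter C m (sqrt_iter C n u)"
proof (rule sqrt_iter_commute_base[OF sqrt_iter_bounded_clinear])
  show "C (sqrt_iter C m u) = sqrt_iter C m (C u)" for u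
    using sqrt_iter_commute_base[OF C] by simp
qed

lemma sqrt_iter_symmetric:
  assumes "\<And>u v. cinner (C u) v = cinner u (C v)"
  shows "cinner (sqrt_iter C n u) v = cinner u (sqrt_iter C n v)"
  by (induction n arbitrary: u v) (simp_all add: assms cinner_simps)

lemma norm_sqrt_iter_le: "norm (sqrt_iter C n u) \<le> sqrt_iter_real n * norm u"
proof (induction n arbitrary: u)
  case (Suc n)
  have "norm (sqrt_iter C n (sqrt_iter C n u)) \<le> sqrt_iter_real n * (sqrt_iter_real n * norm u)"
    using Suc sqrt_iter_real_bounds[of n] by (meson mult_left_mono order_trans)
  then have "norm (C u + sqrt_iter C n (sqrt_iter C n u))
      \<le> norm u + sqrt_iter_real n * (sqrt_iter_real n * norm u)"
    using contr by (intro norm_triangle_mono)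
  then show ?case
    by (simp add: norm_scaleC norm_divide distrib_right power2_eq_square mult.assoc)
qed simp

lemma norm_sqrt_iter_le_norm: "norm (sqrt_iter C n u) \<le> norm u"
  using norm_sqrt_iter_le[of n u] sqrt_iter_real_bounds[of n]
  by (meson mult_left_le_one_le norm_ge_zero order_trans)

text \<open>The iterates commute, so a difference of squares factors as
  \<open>(Z\<^sub>n\<^sub>+\<^sub>1 + Z\<^sub>n) (Z\<^sub>n\<^sub>+\<^sub>1 - Z\<^sub>n)\<close>,
  exactly as in the scalar recursion; each factor is dominated by its scalar counterpart.\<close>

lemma norm_sqrt_iter_Suc_diff:
  "norm (sqrt_iter C (Suc n) u - sqrt_iter C n u)
    \<le> (sqrt_iter_real (Suc n) - sqrt_iter_real n) * norm u"
proof (induction n arbitrary: u)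
  case 0
  then show ?case using contr by (simp add: norm_scaleC norm_divide)
next
  case (Suc n)
  let ?Z = "sqrt_iter C" and ?z = sqrt_iter_real
  define v where "v = ?Z (Suc n) u - ?Z n u"
  have "?Z (Suc (Suc n)) u - ?Z (Suc n) u =
      (1 / 2) *\<^sub>C (?Z (Suc n) (?Z (Suc n) u) - ?Z n (?Z n u))"
    unfolding sqrt_iter.simps(2)[of C "Suc n"] by (subst (3) sqrt_iter.simps(2))
      (simp del: sqrt_iter.simps add: complex_vector.scale_right_diff_distrib[symmetric])
  also have "\<dots> = (1 / 2) *\<^sub>C (?Z (Suc n) v + ?Z n v)"
    unfolding v_def using sqrt_iter_commute[of "Suc n" n u]
    by (simp del: sqrt_iter.simps add: bounded_clinear_diff[OF sqrt_iter_bounded_clinear])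
  also have "norm \<dots> = norm (?Z (Suc n) v + ?Z n v) / 2"
    by (simp del: sqrt_iter.simps add: norm_scaleC norm_divide)
  also have "\<dots> \<le> (?z (Suc n) * norm v + ?z n * norm v) / 2"
    by (intro divide_right_mono norm_triangle_mono norm_sqrt_iter_le) auto
  also have "\<dots> = (?z (Suc n) + ?z n) / 2 * norm v"
    by (simp only: distrib_right times_divide_eq_left)
  also have "\<dots> \<le> (?z (Suc n) + ?z n) / 2 * ((?z (Suc n) - ?z n) * norm u)"
    unfolding v_def using sqrt_iter_real_bounds[of n] sqrt_iter_real_bounds[of "Suc n"]
    by (intro mult_left_mono Suc) (simp del: sqrt_iter_real.simps)
  also have "\<dots> = (?z (Suc (Suc n)) - ?z (Suc n)) * norm u"
    by (simp only: sqrt_iter_real_Suc_diff) simp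
  finally show ?case .
qed

lemma norm_sqrt_iter_diff:
  assumes "m \<le> n"
  shows "norm (sqrt_iter C n u - sqrt_iter C m u) \<le> (sqrt_iter_real n - sqrt_iter_real m) * norm u"
  using assms
proof (induction n rule: dec_induct)
  case (step n)
  have "norm (sqrt_iter C (Suc n) u - sqrt_iter C m u)
      \<le> norm (sqrt_iter C (Suc n) u - sqrt_iter C n u) + norm (sqrt_iter C n u - sqrt_iter C m u)"
    by (rule order_trans[OF _ norm_triangle_ineq]) simp
  also have "\<dots> \<le> (sqrt_iter_real (Suc n) - sqrt_iter_real n) * norm u +
      (sqrt_iter_real n - sqrt_iter_real m) * norm u"
    by (intro add_mono norm_sqrt_iter_Suc_diff step)
  finally show ?case by (simp only: algebra_simps)
qed simp

lemma convergent_sqrt_iter: "convergent (\<lambda>n. sqrt_iter C n u)"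
proof -
  have "Cauchy (\<lambda>n. sqrt_iter_real n * norm u)"
  proof -
    have "Bseq sqrt_iter_real"
      by (rule BseqI'[of _ 1]) (use sqrt_iter_real_bounds in auto)
    then have "convergent sqrt_iter_real"
      using incseq_sqrt_iter_real by (intro Bseq_mono_convergent) (auto simp: incseq_def)
    then show ?thesis
      by (intro convergent_Cauchy convergent_mult convergent_const)
  qed
  have "Cauchy (\<lambda>n. sqrt_iter C n u)"
  proof (rule CauchyI)
    fix e :: real assume "e > 0"
    then obtain M where M: "\<And>m n. M \<le> m \<Longrightarrow> M \<le> n \<Longrightarrow>
        norm (sqrt_iter_real m * norm u - sqrt_iter_real n * norm u) < e"
      using CauchyD[OF \<open>Cauchy (\<lambda>n. sqrt_iter_real n * norm u)\<close>] by blast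
    have le: "norm (sqrt_iter C n u - sqrt_iter C m u) < e" if "M \<le> m" "m \<le> n" for m n
      using norm_sqrt_iter_diff[OF that(2), of u] M[of n m] that by (simp add: algebra_simps)
    show "\<exists>M. \<forall>m\<ge>M. \<forall>n\<ge>M. norm (sqrt_iter C m u - sqrt_iter C n u) < e"
    proof (intro exI[of _ M] allI impI)
      show "norm (sqrt_iter C m u - sqrt_iter C n u) < e" if "M \<le> m" "M \<le> n" for m n
        using le[of m n] le[of n m] that by (cases "m \<le> n") (auto simp: norm_minus_commute)
    qed
  qed
  then show ?thesis by (rule Cauchy_convergent)
qed

end

text \<open>The approximants \<open>S\<close> belong to the conclusion because existence of a root
  alone is too weak: that the root is a limit of polynomials in \<open>A\<close> is what later
  transports commutation and the trace property to it.\<close>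

lemma positive_contraction_square_root:
  fixes A :: "'h::complex_hilbert_space \<Rightarrow> 'h"
  assumes A: "positive_op A" and le: "\<And>u. norm (A u) \<le> norm u"
  obtains B S where "positive_op B" "\<And>u. B (B u) = A u"
    "\<And>n. S n \<in> generated_algebra {id, A}" "\<And>u. (\<lambda>n. S n u) \<longlonglongrightarrow> B u"
proof -
  define C where "C = id - A"
  have CL: "bounded_clinear C"
    unfolding C_def
    by (intro bounded_clinear_minus bounded_clinear_ident positive_op_bounded_clinear A)
  have Csym: "cinner (C u) v = cinner u (C v)" for u v
    using positive_op_symmetric[OF A] by (simp add: C_def cinner_simps)
  have AC: "Re (cinner (A u) u) \<le> (norm u)\<^sup>2" for u
  proof -
    have "Re (cinner (A u) u) \<le> norm (A u) * norm u"
      using cinner_Cauchy_Schwarz complex_Re_le_cmod order_trans by blast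
    also have "\<dots> \<le> norm u * norm u"
      by (intro mult_right_mono le) simp
    finally show ?thesis by (simp add: power2_eq_square)
  qed
  have Cpos: "positive_op C"
    by (rule positive_opI[OF CL Csym]) (use AC in \<open>simp add: C_def cinner_simps cinner_self\<close>)
  have contr: "norm (C u) \<le> norm u" for u
    by (rule positive_contraction_norm[OF Cpos])
      (use positive_op_Re[OF A] in \<open>simp add: C_def cinner_simps cinner_self\<close>)
  let ?Z = "sqrt_iter C"
  define Z where "Z = (\<lambda>u. lim (\<lambda>n. ?Z n u))"
  have lim: "(\<lambda>n. ?Z n u) \<longlonglongrightarrow> Z u" for u
    unfolding Z_def using convergent_sqrt_iter[OF CL contr] convergent_LIMSEQ_iff by blast
  note ZL = sqrt_iter_bounded_clinear[OF CL contr]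
  have Znorm: "norm (Z u) \<le> norm u" for u
    by (rule LIMSEQ_le_const2[OF tendsto_norm[OF lim]])
      (use norm_sqrt_iter_le_norm[OF CL contr] in blast)
  have ZBL: "bounded_clinear Z"
  proof (rule bounded_clinearI[of _ 1])
    show "Z (u + v) = Z u + Z v" for u v
      using lim[of "u + v"] tendsto_add[OF lim[of u] lim[of v]]
      by (simp add: bounded_clinear_simps[OF ZL] LIMSEQ_unique)
    show "Z (c *\<^sub>C u) = c *\<^sub>C Z u" for c u
      using lim[of "c *\<^sub>C u"] tendsto_scaleC[OF lim[of u], of c]
      by (simp add: bounded_clinear_simps[OF ZL] LIMSEQ_unique)
  qed (use Znorm in simp)
  have Zsym: "cinner (Z u) v = cinner u (Z v)" for u v
    using tendsto_cinner[OF lim[of u] tendsto_const[of v]]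
      tendsto_cinner[OF tendsto_const[of u] lim[of v]]
    by (simp add: sqrt_iter_symmetric[OF CL contr Csym] LIMSEQ_unique)
  \<comment> \<open>Strong convergence does not pass to products by itself; the uniform bound 1 on
    the norms of the iterates makes \<open>?Z n (?Z n u - Z u)\<close> tend to 0.\<close>
  have ZZ: "(\<lambda>n. ?Z n (?Z n u)) \<longlonglongrightarrow> Z (Z u)" for u
  proof -
    have "(\<lambda>n. ?Z n (?Z n u - Z u)) \<longlonglongrightarrow> 0"
    proof (rule Lim_null_comparison)
      show "\<forall>\<^sub>F n in sequentially. norm (?Z n (?Z n u - Z u)) \<le> norm (?Z n u - Z u)"
        using norm_sqrt_iter_le_norm[OF CL contr] by simp
      show "(\<lambda>n. norm (?Z n u - Z u)) \<longlonglongrightarrow> 0"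
        using lim[of u] by (simp add: LIM_zero tendsto_norm_zero)
    qed
    from tendsto_add[OF this lim[of "Z u"]] show ?thesis
      by (simp add: bounded_clinear_simps[OF ZL])
  qed
  \<comment> \<open>The limit satisfies \<open>2 Z = C + Z\<^sup>2\<close>, which rearranges to
    \<open>(1 - Z)\<^sup>2 = 1 - C = A\<close>.\<close>
  have fix_eq: "Z u = (1 / 2) *\<^sub>C (C u + Z (Z u))" for u
  proof (rule LIMSEQ_unique)
    show "(\<lambda>n. ?Z (Suc n) u) \<longlonglongrightarrow> Z u"
      by (rule LIMSEQ_Suc[OF lim])
    show "(\<lambda>n. ?Z (Suc n) u) \<longlonglongrightarrow> (1 / 2) *\<^sub>C (C u + Z (Z u))"
      unfolding sqrt_iter.simps by (intro tendsto_intros ZZ)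
  qed
  define B where "B = id - Z"
  define S where "S = (\<lambda>n. id - ?Z n)"
  have CG: "C \<in> generated_algebra {id, A}"
  proof -
    have "C = id + (\<lambda>u. (- 1) *\<^sub>C A u)"
      by (auto simp: C_def)
    then show ?thesis
      by (simp only:) (intro generated_algebra.add generated_algebra.scale generated_algebra.generator; simp)
  qed
  have ZG: "?Z n \<in> generated_algebra {id, A}" for n
  proof (induction n)
    case 0
    have "?Z 0 = (\<lambda>u. 0 *\<^sub>C id u)"
      by (auto simp: fun_eq_iff)
    then show ?case
      by (simp only:) (intro generated_algebra.scale generated_algebra.generator; simp)
  next
    case (Suc n)
    have "?Z (Suc n) = (\<lambda>u. (1 / 2) *\<^sub>C (C + (?Z n \<circ> ?Z n)) u)"
      by (auto simp: fun_eq_iff)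
    then show ?case
      using CG Suc by (simp only: generated_algebra.intros)
  qed
  show ?thesis
  proof (rule that)
    show "positive_op B"
    proof (rule positive_opI)
      show "bounded_clinear B"
        unfolding B_def by (intro bounded_clinear_minus bounded_clinear_ident ZBL)
      show "cinner (B u) v = cinner u (B v)" for u v
        by (simp add: B_def cinner_simps Zsym)
      have "Re (cinner (Z u) u) \<le> norm (Z u) * norm u" for u
        using cinner_Cauchy_Schwarz complex_Re_le_cmod order_trans by blast
      also have "norm (Z u) * norm u \<le> norm u * norm u" for u
        by (intro mult_right_mono Znorm) simp
      finally show "Re (cinner (B u) u) \<ge> 0" for u
        by (simp add: B_def cinner_simps cinner_self power2_eq_square)
    qed
    show "B (B u) = A u" for u
    proof -
      have "Z u + Z u = C u + Z (Z u)"
        using arg_cong[OF fix_eq[of u], of "\<lambda>v. 2 *\<^sub>C v"] scaleC_add_left[of 1 1 "Z u"]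
        by (simp add: scaleC_scaleC)
      then have "A u = u - (Z u + Z u) + Z (Z u)"
        by (simp add: C_def)
      then show ?thesis
        by (simp add: B_def bounded_clinear_simps[OF ZBL])
    qed
    show "S n \<in> generated_algebra {id, A}" for n
    proof -
      have "S n = id + (\<lambda>u. (- 1) *\<^sub>C ?Z n u)"
        by (auto simp: S_def)
      then show ?thesis
        by (simp only:) (intro generated_algebra.add generated_algebra.scale ZG generated_algebra.generator; simp)
    qed
    show "(\<lambda>n. S n u) \<longlonglongrightarrow> B u" for u
      unfolding S_def B_def by (simp add: lim tendsto_diff)
  qed
qed

section \<open>Roots of arbitrary positive operators and \<open>op_sqrt\<close>\<close>

lemma generated_algebra_mono:
  assumes "A \<in> generated_algebra S" "S \<subseteq> generated_algebra T"
  shows "A \<in> generated_algebra T"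
  using assms(1) by induction (use assms(2) in \<open>blast intro: generated_algebra.intros\<close>)+

lemma positive_op_scale:
  assumes "positive_op A" "r \<ge> 0"
  shows "positive_op (\<lambda>u. of_real r *\<^sub>C A u)"
  using assms positive_op_symmetric[OF assms(1)] positive_op_Re[OF assms(1)]
  by (intro positive_opI) (auto simp: cinner_simps intro: bounded_clinear_scale positive_op_bounded_clinear)

lemma positive_op_square_root_ex:
  fixes A :: "'h::complex_hilbert_space \<Rightarrow> 'h"
  assumes A: "positive_op A"
  obtains B S where "positive_op B" "\<And>u. B (B u) = A u"
    "\<And>n. S n \<in> generated_algebra {id, A}" "\<And>u. (\<lambda>n. S n u) \<longlonglongrightarrow> B u"
proof -
  obtain M where M: "M > 0" "\<And>u. norm (A u) \<le> norm u * M"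
    using bounded_linear.pos_bounded[OF bounded_clinear_bounded_linear[OF positive_op_bounded_clinear[OF A]]]
    by blast
  \<comment> \<open>Dividing by the norm bound \<open>M\<close> makes \<open>A\<close> a
    contraction; the root is multiplied by \<open>sqrt M\<close> afterwards.\<close>
  define A' where "A' = (\<lambda>u. of_real (1 / M) *\<^sub>C A u)"
  have A': "positive_op A'"
    unfolding A'_def by (rule positive_op_scale) (use A M in auto)
  have le: "norm (A' u) \<le> norm u" for u
    using M(1) M(2)[of u] by (simp add: A'_def norm_scaleC field_simps norm_divide)
  obtain B S where B: "positive_op B" "\<And>u. B (B u) = A' u"
    "\<And>n. S n \<in> generated_algebra {id, A'}" "\<And>u. (\<lambda>n. S n u) \<longlonglongrightarrow> B u"
    by (rule positive_contraction_square_root[OF A' le]) (rule that)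
  have sub: "{id, A'} \<subseteq> generated_algebra {id, A}"
    unfolding A'_def by (blast intro: generated_algebra.scale generated_algebra.generator)
  show ?thesis
  proof (rule that)
    show "positive_op (\<lambda>u. of_real (sqrt M) *\<^sub>C B u)"
      by (rule positive_op_scale) (use B M in auto)
    have "complex_of_real (sqrt M) * complex_of_real (sqrt M) = complex_of_real M"
      using M(1) by (simp flip: of_real_mult)
    then show "of_real (sqrt M) *\<^sub>C B (of_real (sqrt M) *\<^sub>C B u) = A u" for u
      using M(1) by (simp add: bounded_clinear_simps[OF positive_op_bounded_clinear[OF B(1)]]
          B(2) scaleC_scaleC A'_def)
    show "(\<lambda>u. of_real (sqrt M) *\<^sub>C S n u) \<in> generated_algebra {id, A}" for n
      by (intro generated_algebra.scale generated_algebra_mono[OF B(3) sub])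
    show "(\<lambda>n. of_real (sqrt M) *\<^sub>C S n u) \<longlonglongrightarrow> of_real (sqrt M) *\<^sub>C B u" for u
      by (intro tendsto_intros B)
  qed
qed

lemma strong_limit_commute:
  assumes B: "bounded_clinear B" and comm: "\<And>u. A (B u) = B (A u)"
    and S: "\<And>n. S n \<in> generated_algebra {id, A}" "\<And>u. (\<lambda>n. S n u) \<longlonglongrightarrow> R u"
  shows "R (B u) = B (R u)"
proof (rule LIMSEQ_unique[OF S(2)])
  have "S n (B v) = B (S n v)" for n v
    by (rule generated_algebra_commute[OF B _ S(1)]) (use comm in auto)
  then show "(\<lambda>n. S n (B u)) \<longlonglongrightarrow> B (R u)"
    using bounded_clinear_tendsto[OF B S(2)] by simp
qed

text \<open>Any positive root \<open>D\<close> commutes with \<open>A = D\<^sup>2\<close>, hence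
  with the root \<open>R\<close> constructed as a limit of polynomials in \<open>A\<close>.
  Uniqueness among commuting roots then applies to \<open>D\<close> and \<open>R\<close>, so the
  definite description is justified.\<close>

lemma op_sqrt_eqI:
  assumes B: "positive_op B" and sq: "\<And>u. B (B u) = A u" and A: "positive_op A"
  shows "op_sqrt A = B"
proof -
  obtain R S where R: "positive_op R" "\<And>u. R (R u) = A u"
    "\<And>n. S n \<in> generated_algebra {id, A}" "\<And>u. (\<lambda>n. S n u) \<longlonglongrightarrow> R u"
    by (rule positive_op_square_root_ex[OF A]) (rule that)
  have uniq: "D = R" if D: "positive_op D" "\<And>u. D (D u) = A u" for D
  proof (rule positive_op_square_root_unique[OF D(1) R(1)])
    have "A (D v) = D (A v)" for v
      by (simp flip: D(2))
    from strong_limit_commute[where B = D, OF positive_op_bounded_clinear[OF D(1)] this R(3,4)]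
    show "D (R v) = R (D v)" for v
      by simp
  qed (simp add: R(2) D(2))
  have "op_sqrt A = R"
    unfolding op_sqrt_def
  proof (rule the_equality)
    show "positive_op R \<and> R \<circ> R = A"
      using R by auto
    show "D = R" if "positive_op D \<and> D \<circ> D = A" for D
      using that by (intro uniq) (auto simp: fun_eq_iff)
  qed
  also have "R = B"
    by (rule uniq[OF B sq, symmetric])
  finally show ?thesis .
qed

lemma op_sqrt_approx:
  assumes "positive_op A"
  obtains S where "\<And>n. S n \<in> generated_algebra {id, A}" "\<And>u. (\<lambda>n. S n u) \<longlonglongrightarrow> op_sqrt A u"
proof -
  obtain B S where "positive_op B" "\<And>u. B (B u) = A u"
    and S: "\<And>n. S n \<in> generated_algebra {id, A}" "\<And>u. (\<lambda>n. S n u) \<longlonglongrightarrow> B u"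
    by (rule positive_op_square_root_ex[OF assms]) (rule that)
  then have "op_sqrt A = B"
    by (intro op_sqrt_eqI assms)
  with S that show ?thesis by blast
qed

lemma
  assumes "positive_op A"
  shows positive_op_sqrt: "positive_op (op_sqrt A)"
    and op_sqrt_square: "op_sqrt A (op_sqrt A u) = A u"
proof -
  obtain B S where B: "positive_op B" "\<And>u. B (B u) = A u"
    and "\<And>n. S n \<in> generated_algebra {id, A}" "\<And>u. (\<lambda>n. S n u) \<longlonglongrightarrow> B u"
    by (rule positive_op_square_root_ex[OF assms]) (rule that)
  then have "op_sqrt A = B"
    by (intro op_sqrt_eqI assms)
  with B show "positive_op (op_sqrt A)" "op_sqrt A (op_sqrt A u) = A u"
    by auto
qed

lemma op_sqrt_commute:
  assumes "positive_op A" "bounded_clinear B" "\<And>u. A (B u) = B (A u)"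
  shows "op_sqrt A (B u) = B (op_sqrt A u)"
proof -
  obtain S where "\<And>n. S n \<in> generated_algebra {id, A}" "\<And>u. (\<lambda>n. S n u) \<longlonglongrightarrow> op_sqrt A u"
    by (rule op_sqrt_approx[OF assms(1)]) (rule that)
  then show ?thesis
    by (rule strong_limit_commute[where A = A and B = B, OF assms(2,3)])
qed

text \<open>With \<open>q\<close> the root of \<open>B\<close>, which also commutes with
  \<open>A\<close>, the product is \<open>q A q\<close>, and its form at \<open>u\<close> is that of
  \<open>A\<close> at \<open>q u\<close>.\<close>

lemma positive_op_comp_commute:
  assumes A: "positive_op A" and B: "positive_op B" and comm: "\<And>u. A (B u) = B (A u)"
  shows "positive_op (A \<circ> B)"
proof (rule positive_opI)
  let ?q = "op_sqrt B"
  have q: "A (?q u) = ?q (A u)" for u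
    using op_sqrt_commute[OF B positive_op_bounded_clinear[OF A]] comm by simp
  show "bounded_clinear (A \<circ> B)"
    by (intro bounded_clinear_comp positive_op_bounded_clinear A B)
  show "cinner ((A \<circ> B) u) v = cinner u ((A \<circ> B) v)" for u v
    by (simp add: positive_op_symmetric[OF A] positive_op_symmetric[OF B] comm)
  have "cinner (A (B u)) u = cinner (A (?q u)) (?q u)" for u
    using positive_op_symmetric[OF positive_op_sqrt[OF B], of "A (?q u)" u]
    by (simp add: op_sqrt_square[OF B, symmetric] q)
  then show "Re (cinner ((A \<circ> B) u) u) \<ge> 0" for u
    using positive_op_Re[OF A] by simp
qed

text \<open>With \<open>R\<close> the root, \<open>(R + 1) (R - 1) u = A u - u = 0\<close>, and
  \<open>R + 1\<close> is injective because \<open>R\<close> is positive.\<close>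

lemma op_sqrt_fixed:
  assumes A: "positive_op A" and "A u = u"
  shows "op_sqrt A u = u"
proof -
  note R = positive_op_sqrt[OF A]
  define v where "v = op_sqrt A u - u"
  have "op_sqrt A v + v = 0"
    using assms by (simp add: v_def bounded_clinear_simps[OF positive_op_bounded_clinear[OF R]]
        op_sqrt_square)
  then have "Re (cinner (op_sqrt A v) v) + Re (cinner v v) = 0"
    by (metis cinner_add_left cinner_zero_left plus_complex.simps(1) zero_complex.simps(1))
  then have "Re (cinner v v) \<le> 0"
    using positive_op_Re[OF R, of v] by simp
  then show ?thesis
    by (simp add: cinner_self v_def)
qed

section \<open>Ampliations and orthogonal projections\<close>

text \<open>The operator is given by a linear relation \<open>G\<close>, because a vector can be a
  sum of simple tensors in many ways. The bound settles well-definedness and extension together: two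
  values over one vector differ by something of norm 0, and values along a Cauchy sequence are
  Cauchy, so the closure of \<open>G\<close> is the graph of the extension.\<close>

lemma bounded_clinear_extension:
  fixes G :: "('a::complex_hilbert_space \<times> 'b::complex_hilbert_space) set"
  assumes add: "\<And>u v u' v'. (u, v) \<in> G \<Longrightarrow> (u', v') \<in> G \<Longrightarrow> (u + u', v + v') \<in> G"
    and scale: "\<And>c u v. (u, v) \<in> G \<Longrightarrow> (c *\<^sub>C u, c *\<^sub>C v) \<in> G"
    and bound: "\<And>u v. (u, v) \<in> G \<Longrightarrow> norm v \<le> norm u * M"
    and dense: "closure (fst ` G) = UNIV"
  obtains A where "bounded_clinear A" "\<And>u v. (u, v) \<in> G \<Longrightarrow> A u = v"
proof -
  define H where "H = closure G"
  have Hadd: "(u + u', v + v') \<in> H" if uv: "(u, v) \<in> H" "(u', v') \<in> H" for u v u' v'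
  proof -
    obtain s where s: "\<And>n. s n \<in> G" "s \<longlonglongrightarrow> (u, v)"
      using uv(1) unfolding H_def closure_sequential by blast
    obtain s' where s': "\<And>n. s' n \<in> G" "s' \<longlonglongrightarrow> (u', v')"
      using uv(2) unfolding H_def closure_sequential by blast
    have "s n + s' n \<in> G" for n
      using add[of "fst (s n)" "snd (s n)" "fst (s' n)" "snd (s' n)"] s(1)[of n] s'(1)[of n]
      by (simp add: plus_prod_def)
    moreover have "(\<lambda>n. s n + s' n) \<longlonglongrightarrow> (u + u', v + v')"
      using tendsto_add[OF s(2) s'(2)] by simp
    ultimately show ?thesis
      unfolding H_def closure_sequential by (intro exI[of _ "\<lambda>n. s n + s' n"]) auto
  qed
  have Hscale: "(c *\<^sub>C u, c *\<^sub>C v) \<in> H" if uv: "(u, v) \<in> H" for c u v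
  proof -
    obtain s where s: "\<And>n. s n \<in> G" "s \<longlonglongrightarrow> (u, v)"
      using uv unfolding H_def closure_sequential by blast
    have "(c *\<^sub>C fst (s n), c *\<^sub>C snd (s n)) \<in> G" for n
      using scale s(1) by simp
    moreover have "(\<lambda>n. (c *\<^sub>C fst (s n), c *\<^sub>C snd (s n))) \<longlonglongrightarrow> (c *\<^sub>C u, c *\<^sub>C v)"
      using tendsto_fst[OF s(2)] tendsto_snd[OF s(2)] by (auto intro!: tendsto_intros)
    ultimately show ?thesis
      unfolding H_def closure_sequential
      by (intro exI[of _ "\<lambda>n. (c *\<^sub>C fst (s n), c *\<^sub>C snd (s n))"]) auto
  qed
  have Hbound: "norm v \<le> norm u * M" if uv: "(u, v) \<in> H" for u v
  proof -
    obtain s where s: "\<And>n. s n \<in> G" "s \<longlonglongrightarrow> (u, v)"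
      using uv unfolding H_def closure_sequential by blast
    have L: "(\<lambda>n. norm (snd (s n))) \<longlonglongrightarrow> norm v" "(\<lambda>n. norm (fst (s n)) * M) \<longlonglongrightarrow> norm u * M"
      using tendsto_fst[OF s(2)] tendsto_snd[OF s(2)] by (auto intro!: tendsto_intros)
    have "norm (snd (s n)) \<le> norm (fst (s n)) * M" for n
      using bound[of "fst (s n)" "snd (s n)"] s(1)[of n] by simp
    then show ?thesis
      by (intro LIMSEQ_le[OF L]) blast
  qed
  have Hdiff: "(u - u', v - v') \<in> H" if "(u, v) \<in> H" "(u', v') \<in> H" for u v u' v'
    using Hadd[OF that(1) Hscale[OF that(2), of "- 1"]] by simp
  have Huniq: "v = v'" if "(u, v) \<in> H" "(u, v') \<in> H" for u v v'
    using Hbound[OF Hdiff[OF that]] by simp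
  have Hex: "\<exists>v. (u, v) \<in> H" for u
  proof -
    obtain f where f: "\<And>n. f n \<in> fst ` G" "f \<longlonglongrightarrow> u"
      using dense closure_sequential by blast
    have "\<exists>v. (f n, v) \<in> G" for n
      using f(1)[of n] by force
    then obtain g where g: "\<And>n. (f n, g n) \<in> G"
      by metis
    have le: "norm (g m - g n) \<le> norm (f m - f n) * M" for m n
      using g closure_subset[of G] by (intro Hbound Hdiff) (auto simp: H_def)
    have "Cauchy (\<lambda>n. g n)"
    proof (rule CauchyI)
      fix e :: real assume e: "e > 0"
      \<comment> \<open>\<open>M\<close> is not assumed positive, whereas the bound used as a
        divisor has to be.\<close>
      define M' where "M' = \<bar>M\<bar> + 1"
      have M': "M' > 0" "M \<le> M'" by (auto simp: M'_def)
      obtain k where k: "\<And>m n. k \<le> m \<Longrightarrow> k \<le> n \<Longrightarrow> norm (f m - f n) < e / M'"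
        using CauchyD[OF LIMSEQ_imp_Cauchy[OF f(2)], of "e / M'"] e M' by auto
      have "norm (g m - g n) < e" if "k \<le> m" "k \<le> n" for m n
      proof -
        have "norm (g m - g n) \<le> norm (f m - f n) * M'"
          using le[of m n] mult_left_mono[OF M'(2), of "norm (f m - f n)"] by simp
        also have "\<dots> < e"
          using k[OF that] M' by (simp add: field_simps)
        finally show ?thesis .
      qed
      then show "\<exists>k. \<forall>m\<ge>k. \<forall>n\<ge>k. norm (g m - g n) < e" by blast
    qed
    then obtain v where "g \<longlonglongrightarrow> v"
      using Cauchy_convergent convergent_def by blast
    then have "(\<lambda>n. (f n, g n)) \<longlonglongrightarrow> (u, v)"
      using f(2) by (intro tendsto_Pair)
    then have "(u, v) \<in> H"
      unfolding H_def closure_sequential using g by (intro exI[of _ "\<lambda>n. (f n, g n)"]) auto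
    then show ?thesis ..
  qed
  define A where "A = (\<lambda>u. THE v. (u, v) \<in> H)"
  have AH: "A u = v" if "(u, v) \<in> H" for u v
    unfolding A_def using that Huniq by blast
  have HA: "(u, A u) \<in> H" for u
    using Hex[of u] AH by auto
  show ?thesis
  proof (rule that)
    show "bounded_clinear A"
      by (rule bounded_clinearI[of A M]) (intro AH Hadd Hscale Hbound HA)+
    show "A u = v" if "(u, v) \<in> G" for u v
      using that closure_subset[of G] by (intro AH) (auto simp: H_def)
  qed
qed

text \<open>One Gram-Schmidt step: each \<open>w i\<close> loses its component along the pivot
  \<open>w k\<close>. The pivot itself becomes 0, and the removed rank-one part of the Gram matrix
  contributes a squared norm. If \<open>w k = 0\<close>, division by zero yields 0 and the formula
  persists.\<close>

lemma gram_sum_split: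
  fixes z :: "'i \<Rightarrow> 'a::complex_hilbert_space" and w :: "'i \<Rightarrow> 'k::complex_hilbert_space"
  assumes "finite I" "k \<notin> I"
  defines "w' \<equiv> \<lambda>i. w i - (cinner (w i) (w k) / cinner (w k) (w k)) *\<^sub>C w k"
  shows "(\<Sum>i\<in>insert k I. \<Sum>j\<in>insert k I. cinner (z i) (z j) * cinner (w i) (w j)) =
    (\<Sum>i\<in>I. \<Sum>j\<in>I. cinner (z i) (z j) * cinner (w' i) (w' j)) +
    of_real ((norm (\<Sum>i\<in>insert k I. cinner (w i) (w k) *\<^sub>C z i))\<^sup>2 / (norm (w k))\<^sup>2)"
proof -
  let ?e = "w k" and ?J = "insert k I"
  have split: "cinner (w i) (w j) = cinner (w' i) (w' j) +
      cinner (w i) ?e * cnj (cinner (w j) ?e) / cinner ?e ?e" for i j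
  proof (cases "?e = 0")
    case False
    define \<alpha> \<beta> \<gamma> where "\<alpha> = cinner (w i) ?e" and "\<beta> = cinner (w j) ?e" and "\<gamma> = cinner ?e ?e"
    have e: "cinner ?e (w j) = cnj \<beta>" and \<gamma>: "cnj \<gamma> = \<gamma>" "\<gamma> \<noteq> 0"
      using False unfolding \<beta>_def \<gamma>_def by (auto intro: cinner_commute cinner_commute[symmetric])
    have "cinner (w' i) (w' j) = cinner (w i) (w j) - cnj (\<beta> / \<gamma>) * \<alpha>
        - \<alpha> / \<gamma> * cinner ?e (w j) + \<alpha> / \<gamma> * cnj (\<beta> / \<gamma>) * \<gamma>"
      unfolding w'_def \<alpha>_def \<beta>_def \<gamma>_def by (simp add: cinner_simps algebra_simps)
    moreover have "\<alpha> / \<gamma> * cnj (\<beta> / \<gamma>) * \<gamma> = \<alpha> * cnj \<beta> / \<gamma>"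
      using \<gamma> by simp
    ultimately show ?thesis
      unfolding e \<alpha>_def[symmetric] \<beta>_def[symmetric] \<gamma>_def[symmetric]
      by (simp add: \<gamma>(1) mult.commute)
  qed (simp add: w'_def)
  have "w' k = 0"
    by (cases "?e = 0") (auto simp: w'_def)
  then have red: "(\<Sum>i\<in>?J. \<Sum>j\<in>?J. cinner (z i) (z j) * cinner (w' i) (w' j)) =
      (\<Sum>i\<in>I. \<Sum>j\<in>I. cinner (z i) (z j) * cinner (w' i) (w' j))"
    using assms by simp
  have "(\<Sum>i\<in>?J. \<Sum>j\<in>?J. cinner (z i) (z j) *
        (cinner (w i) ?e * cnj (cinner (w j) ?e) / cinner ?e ?e)) =
      cinner (\<Sum>i\<in>?J. cinner (w i) ?e *\<^sub>C z i) (\<Sum>j\<in>?J. cinner (w j) ?e *\<^sub>C z j) / cinner ?e ?e"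
  proof -
    have "cinner (\<Sum>i\<in>?J. cinner (w i) ?e *\<^sub>C z i) (\<Sum>j\<in>?J. cinner (w j) ?e *\<^sub>C z j) =
        (\<Sum>i\<in>?J. \<Sum>j\<in>?J. cinner (cinner (w i) ?e *\<^sub>C z i) (cinner (w j) ?e *\<^sub>C z j))"
      by (subst cinner_sum_left) (simp only: cinner_sum_right)
    also have "\<dots> = (\<Sum>i\<in>?J. \<Sum>j\<in>?J. cinner (z i) (z j) * (cinner (w i) ?e * cnj (cinner (w j) ?e)))"
      by (intro sum.cong refl) (simp only: cinner_scaleC_left cinner_scaleC_right mult_ac)
    finally show ?thesis
      by (simp only: sum_divide_distrib times_divide_eq_right)
  qed
  moreover have "(\<Sum>i\<in>?J. \<Sum>j\<in>?J. cinner (z i) (z j) * cinner (w i) (w j)) =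
      (\<Sum>i\<in>?J. \<Sum>j\<in>?J. cinner (z i) (z j) * (cinner (w' i) (w' j) +
        cinner (w i) ?e * cnj (cinner (w j) ?e) / cinner ?e ?e))"
    by (intro sum.cong refl arg_cong[OF split])
  ultimately show ?thesis
    unfolding red[symmetric] by (simp only: distrib_left sum.distrib cinner_self of_real_divide)
qed

text \<open>This is the bound on \<open>a \<otimes> 1\<close> at the vector
  \<open>\<Sum> z i \<otimes> w i\<close>, phrased without forming a tensor product. Gram-Schmidt
  removes one index at a time, and each removed term reduces to the bound on \<open>a\<close> at a
  single vector. The family \<open>w\<close> varies in the induction since the step replaces it by
  its remainders.\<close>

lemma gram_sum_bounded:
  fixes z :: "'i \<Rightarrow> 'a::complex_hilbert_space" and w :: "'i \<Rightarrow> 'k::complex_hilbert_space"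
    and a :: "'a \<Rightarrow> 'b::complex_hilbert_space"
  assumes a: "bounded_clinear a" and M: "\<And>u. norm (a u) \<le> norm u * M" and "finite I"
  shows "Re (\<Sum>i\<in>I. \<Sum>j\<in>I. cinner (a (z i)) (a (z j)) * cinner (w i) (w j))
    \<le> M\<^sup>2 * Re (\<Sum>i\<in>I. \<Sum>j\<in>I. cinner (z i) (z j) * cinner (w i) (w j))"
  using \<open>finite I\<close>
proof (induction I arbitrary: w rule: finite_induct)
  case (insert k I)
  have "(\<Sum>i\<in>insert k I. cinner (w i) (w k) *\<^sub>C a (z i)) =
      a (\<Sum>i\<in>insert k I. cinner (w i) (w k) *\<^sub>C z i)"
    by (subst linear_sum[OF bounded_linear.linear[OF bounded_clinear_bounded_linear[OF a]]])
      (simp add: bounded_clinear_scaleC[OF a])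
  moreover have "(norm (a s))\<^sup>2 / (norm (w k))\<^sup>2 \<le> M\<^sup>2 * ((norm s)\<^sup>2 / (norm (w k))\<^sup>2)" for s
  proof -
    have "(norm (a s))\<^sup>2 \<le> (norm s * M)\<^sup>2"
      using M by (intro power_mono) auto
    then show ?thesis
      by (simp add: divide_right_mono power_mult_distrib mult.commute)
  qed
  ultimately show ?case
    unfolding gram_sum_split[OF insert.hyps] plus_complex.simps Re_complex_of_real distrib_left
    by (intro add_mono insert.IH) simp
qed simp

text \<open>The inner products determine the norm of each linearity defect, and it is 0. This is how
  multilinearity of simple tensors is recovered from the inner product formula.\<close>

lemma linear_of_cinner_multiple:
  assumes inner: "\<And>u u'. cinner (f u) (f u') = cinner u u' * c"
  shows "f (u + v) = f u + f v" and "f (d *\<^sub>C u) = d *\<^sub>C f u"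
proof -
  have "cinner (f (u + v) - f u - f v) (f (u + v) - f u - f v) = 0"
    by (simp add: cinner_simps inner algebra_simps)
  then show "f (u + v) = f u + f v" by (simp add: algebra_simps)
  have "cinner (f (d *\<^sub>C u) - d *\<^sub>C f u) (f (d *\<^sub>C u) - d *\<^sub>C f u) = 0"
    by (simp add: cinner_simps inner algebra_simps)
  then show "f (d *\<^sub>C u) = d *\<^sub>C f u" by simp
qed

text \<open>\<open>a \<otimes> 1\<close> on a tensor product given only through its simple tensors \<open>att u w\<close>.\<close>

lemma ampliation_ex1:
  fixes att :: "'c::complex_hilbert_space \<Rightarrow> 'w \<Rightarrow> 'h::complex_hilbert_space"
    and \<tau> :: "'w \<Rightarrow> 'k::complex_hilbert_space"
  assumes inner: "\<And>u u' w w'. w \<in> W \<Longrightarrow> w' \<in> W \<Longrightarrow>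
      cinner (att u w) (att u' w') = cinner u u' * cinner (\<tau> w) (\<tau> w')"
    and dense: "closure (cspan {att u w |u w. w \<in> W}) = UNIV"
    and a: "bounded_clinear a"
  shows "\<exists>!A. bounded_clinear A \<and> (\<forall>u. \<forall>w\<in>W. A (att u w) = att (a u) w)"
proof -
  \<comment> \<open>Lists of pairs are formal sums of simple tensors, with \<open>F b\<close>
    applying \<open>b\<close> to the first factors. The relation \<open>G\<close> pairs the vector
    of a formal sum with its intended image.\<close>
  define F where "F = (\<lambda>b ps. \<Sum>(u :: 'c, w)\<leftarrow>ps. att (b u) w)"
  define G where "G = {(F id ps, F a ps) |ps. snd ` set ps \<subseteq> W}"
  have F_sum: "F b ps = (\<Sum>i<length ps. att (b (fst (ps ! i))) (snd (ps ! i)))" for b ps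
    unfolding F_def by (simp add: sum_list_sum_nth atLeast0LessThan case_prod_beta)
  have norm_F: "(norm (F b ps))\<^sup>2 = Re (\<Sum>i<length ps. \<Sum>j<length ps.
      cinner (b (fst (ps ! i))) (b (fst (ps ! j))) * cinner (\<tau> (snd (ps ! i))) (\<tau> (snd (ps ! j))))"
    if W: "snd ` set ps \<subseteq> W" for b ps
  proof -
    have W': "snd (ps ! i) \<in> W" if "i < length ps" for i
      using W nth_mem[OF that] by blast
    have "cinner (F b ps) (F b ps) = (\<Sum>i<length ps. \<Sum>j<length ps.
      cinner (b (fst (ps ! i))) (b (fst (ps ! j))) * cinner (\<tau> (snd (ps ! i))) (\<tau> (snd (ps ! j))))"
      unfolding F_sum cinner_sum_left cinner_sum_right
      by (subst sum.swap, intro sum.cong refl inner W') auto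
    moreover have "(norm v)\<^sup>2 = Re (cinner v v)" for v :: 'h
      by (simp add: cinner_self)
    ultimately show ?thesis
      by (simp only:)
  qed
  obtain M where M: "M > 0" "\<And>u. norm (a u) \<le> norm u * M"
    using bounded_linear.pos_bounded[OF bounded_clinear_bounded_linear[OF a]] by blast
  have scaleF: "c *\<^sub>C F b ps = F b (map (\<lambda>(u, w). (c *\<^sub>C u, w)) ps)"
    if "bounded_clinear b" "snd ` set ps \<subseteq> W" for b c ps
    using that(2) unfolding F_def
    by (induction ps) (auto simp: scaleC_add_right bounded_clinear_scaleC[OF that(1)]
        linear_of_cinner_multiple(2)[OF inner])
  have spanG: "cspan {att u w |u w. w \<in> W} \<subseteq> fst ` G"
  proof (rule complex_vector.span_minimal)
    show "{att u w |u w. w \<in> W} \<subseteq> fst ` G"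
    proof clarify
      fix u w assume "w \<in> W"
      then have "(att u w, att (a u) w) \<in> G"
        unfolding G_def by (auto simp: F_def intro!: exI[of _ "[(u, w)]"])
      then show "att u w \<in> fst ` G" by force
    qed
    show "complex_vector.subspace (fst ` G)"
    proof (rule complex_vector.subspaceI)
      show "0 \<in> fst ` G"
        by (auto simp: G_def F_def image_iff intro!: exI[of _ "[]"])
    next
      fix x y assume "x \<in> fst ` G" "y \<in> fst ` G"
      then obtain ps qs where "x = F id ps" "y = F id qs" "snd ` set ps \<subseteq> W" "snd ` set qs \<subseteq> W"
        by (auto simp: G_def)
      then have "x + y = F id (ps @ qs)" "snd ` set (ps @ qs) \<subseteq> W"
        by (auto simp: F_def)
      then show "x + y \<in> fst ` G"
        unfolding G_def by force
    next
      fix c x assume "x \<in> fst ` G"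
      then obtain ps where ps: "x = F id ps" "snd ` set ps \<subseteq> W"
        by (auto simp: G_def)
      then have "c *\<^sub>C x = F id (map (\<lambda>(u, w). (c *\<^sub>C u, w)) ps)"
        by (simp add: scaleF[OF bounded_clinear_ident])
      moreover have "snd ` set (map (\<lambda>(u, w). (c *\<^sub>C u, w)) ps) \<subseteq> W"
        using ps(2) by force
      ultimately show "c *\<^sub>C x \<in> fst ` G"
        unfolding G_def by force
    qed
  qed
  obtain A where A: "bounded_clinear A" "\<And>u v. (u, v) \<in> G \<Longrightarrow> A u = v"
  proof (rule bounded_clinear_extension[of G M])
    fix u v u' v' assume "(u, v) \<in> G" "(u', v') \<in> G"
    then obtain ps qs where "u = F id ps" "v = F a ps" "u' = F id qs" "v' = F a qs"
      "snd ` set ps \<subseteq> W" "snd ` set qs \<subseteq> W"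
      by (auto simp: G_def)
    then have "u + u' = F id (ps @ qs)" "v + v' = F a (ps @ qs)" "snd ` set (ps @ qs) \<subseteq> W"
      by (auto simp: F_def)
    then show "(u + u', v + v') \<in> G"
      unfolding G_def by blast
  next
    fix c u v assume "(u, v) \<in> G"
    then obtain ps where ps: "u = F id ps" "v = F a ps" "snd ` set ps \<subseteq> W"
      by (auto simp: G_def)
    let ?qs = "map (\<lambda>(u, w). (c *\<^sub>C u, w)) ps"
    have "c *\<^sub>C u = F id ?qs" "c *\<^sub>C v = F a ?qs" "snd ` set ?qs \<subseteq> W"
      using ps by (auto simp: scaleF[OF bounded_clinear_ident] scaleF[OF a])
    then show "(c *\<^sub>C u, c *\<^sub>C v) \<in> G"
      unfolding G_def by blast
  next
    fix u v assume "(u, v) \<in> G"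
    then obtain ps where ps: "u = F id ps" "v = F a ps" "snd ` set ps \<subseteq> W"
      by (auto simp: G_def)
    have "(norm v)\<^sup>2 \<le> M\<^sup>2 * (norm u)\<^sup>2"
      unfolding ps norm_F[OF ps(3)] id_apply by (rule gram_sum_bounded[OF a M(2)]) simp
    then have "(norm v)\<^sup>2 \<le> (norm u * M)\<^sup>2"
      by (simp add: power_mult_distrib mult.commute)
    then show "norm v \<le> norm u * M"
      using M(1) by (simp add: power2_le_iff_abs_le)
  next
    show "closure (fst ` G) = UNIV"
      using closure_mono[OF spanG] dense by auto
  qed (rule that)
  have A_att: "\<forall>u. \<forall>w\<in>W. A (att u w) = att (a u) w"
  proof (intro allI ballI A(2))
    fix u w assume "w \<in> W"
    then show "(att u w, att (a u) w) \<in> G"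
      unfolding G_def by (auto simp: F_def intro!: exI[of _ "[(u, w)]"])
  qed
  show ?thesis
  proof (rule ex1I[of _ A])
    show "bounded_clinear A \<and> (\<forall>u. \<forall>w\<in>W. A (att u w) = att (a u) w)"
      using A(1) A_att by blast
    show "B = A" if "bounded_clinear B \<and> (\<forall>u. \<forall>w\<in>W. B (att u w) = att (a u) w)" for B
      by (rule bounded_clinear_eqI[OF _ A(1) dense]) (use that A_att in auto)
  qed
qed

section \<open>Orthogonal projections onto closed spans\<close>

lemma closure_cspan_base: "b \<in> B \<Longrightarrow> b \<in> closure (cspan B)"
  for b :: "'h::complex_hilbert_space"
  by (rule subsetD[OF closure_subset]) (rule complex_vector.span_base)

lemma subspace_closure_cspan:
  fixes B :: "'h::complex_hilbert_space set"
  shows "complex_vector.subspace (closure (cspan B))"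
proof (rule complex_vector.subspaceI)
  show "0 \<in> closure (cspan B)"
    using closure_subset complex_vector.span_zero by blast
next
  fix u v assume uv: "u \<in> closure (cspan B)" "v \<in> closure (cspan B)"
  then obtain f g where "\<And>n. f n \<in> cspan B" "f \<longlonglongrightarrow> u" "\<And>n. g n \<in> cspan B" "g \<longlonglongrightarrow> v"
    unfolding closure_sequential by metis
  then show "u + v \<in> closure (cspan B)"
    unfolding closure_sequential
    by (intro exI[of _ "\<lambda>n. f n + g n"]) (auto intro: tendsto_add complex_vector.span_add)
next
  fix c u assume "u \<in> closure (cspan B)"
  then obtain f where "\<And>n. f n \<in> cspan B" "f \<longlonglongrightarrow> u"
    unfolding closure_sequential by metis
  then show "c *\<^sub>C u \<in> closure (cspan B)"
    unfolding closure_sequential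
    by (intro exI[of _ "\<lambda>n. c *\<^sub>C f n"]) (auto intro: tendsto_scaleC complex_vector.span_scale)
qed

lemma cinner_closure_cspan_eq_0:
  assumes "\<And>b. b \<in> B \<Longrightarrow> cinner b v = 0" "s \<in> closure (cspan B)"
  shows "cinner s v = 0"
proof -
  have "cspan B \<subseteq> {u. cinner u v = 0}"
    by (rule complex_vector.span_minimal)
      (use assms(1) in \<open>auto simp: complex_vector.subspace_def cinner_simps\<close>)
  then have "closure (cspan B) \<subseteq> {u. cinner u v = 0}"
    by (rule closure_minimal) (rule closed_cinner_eq_0)
  with assms(2) show ?thesis by blast
qed

lemma norm_le_of_orthogonal:
  assumes "cinner (u - p) p = 0"
  shows "norm p \<le> norm u"
proof -
  have "cinner u p = cinner p p"
    using assms by (simp add: cinner_simps)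
  then have "(norm p)\<^sup>2 \<le> norm u * norm p"
    using cinner_Cauchy_Schwarz[of u p] by (simp add: cinner_self norm_power)
  then show ?thesis
    by (cases "p = 0") (auto simp: power2_eq_square)
qed

text \<open>The difference of two projected vectors is the projection of the difference, hence no
  longer than it. So the projections of a convergent sequence are Cauchy.\<close>

lemma orthogonal_split_closed:
  fixes S :: "'h::complex_hilbert_space set"
  assumes S: "complex_vector.subspace S" "closed S"
    and f: "\<And>n. \<exists>p\<in>S. \<forall>s\<in>S. cinner (f n - p) s = 0" "f \<longlonglongrightarrow> v"
  shows "\<exists>p\<in>S. \<forall>s\<in>S. cinner (v - p) s = 0"
proof -
  obtain p where p: "\<And>n. p n \<in> S" "\<And>n s. s \<in> S \<Longrightarrow> cinner (f n - p n) s = 0"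
    using f(1) by metis
  have le: "norm (p m - p n) \<le> norm (f m - f n)" for m n
  proof (rule norm_le_of_orthogonal)
    have "p m - p n \<in> S"
      by (intro complex_vector.subspace_diff S p)
    then show "cinner (f m - f n - (p m - p n)) (p m - p n) = 0"
      using p(2)[of "p m - p n" m] p(2)[of "p m - p n" n] by (simp add: cinner_diff_left)
  qed
  have "Cauchy p"
  proof (rule CauchyI)
    fix e :: real assume "e > 0"
    then show "\<exists>M. \<forall>m\<ge>M. \<forall>n\<ge>M. norm (p m - p n) < e"
      using CauchyD[OF LIMSEQ_imp_Cauchy[OF f(2)], of e] le by (meson le_less_trans)
  qed
  then obtain q where q: "p \<longlonglongrightarrow> q"
    using Cauchy_convergent convergent_def by blast
  have "q \<in> S"
    using S(2) p(1) q closed_sequentially by blast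
  moreover have "cinner (v - q) s = 0" if "s \<in> S" for s
  proof -
    have "(\<lambda>n. cinner (f n - p n) s) \<longlonglongrightarrow> cinner (v - q) s"
      by (intro tendsto_intros f q)
    then show ?thesis
      using p(2)[OF that] by (simp add: LIMSEQ_const_iff)
  qed
  ultimately show ?thesis by blast
qed

text \<open>No minimization is involved: each \<open>d\<close> in the total set \<open>D\<close>
  either lies in \<open>B\<close> and is its own projection, or is orthogonal to \<open>B\<close>
  and projects to 0. Linearity and the closedness argument do the rest.\<close>

lemma orthogonal_split_ex:
  fixes B D :: "'h::complex_hilbert_space set"
  assumes dense: "closure (cspan D) = UNIV"
    and orth: "\<And>d b. d \<in> D \<Longrightarrow> b \<in> B \<Longrightarrow> d \<notin> B \<Longrightarrow> cinner b d = 0"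
  shows "\<exists>p\<in>closure (cspan B). \<forall>s\<in>closure (cspan B). cinner (v - p) s = 0"
proof -
  let ?S = "closure (cspan B)"
  note sub = subspace_closure_cspan[of B]
  define N where "N = {v. \<exists>p\<in>?S. \<forall>s\<in>?S. cinner (v - p) s = 0}"
  have NI: "v \<in> N" if "p \<in> ?S" "\<And>s. s \<in> ?S \<Longrightarrow> cinner (v - p) s = 0" for v p
    using that unfolding N_def by blast
  have "cspan D \<subseteq> N"
  proof (rule complex_vector.span_minimal)
    show "D \<subseteq> N"
    proof
      fix d assume d: "d \<in> D"
      show "d \<in> N"
      proof (cases "d \<in> B")
        case True
        then have "d \<in> ?S"
          using closure_subset complex_vector.span_base by blast
        then show ?thesis
          by (rule NI) simp
      next
        case False
        have "cinner d s = 0" if "s \<in> ?S" for s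
        proof -
          have "cinner s d = 0"
            using orth[OF d _ False] by (rule cinner_closure_cspan_eq_0[OF _ that])
          then show ?thesis
            using cinner_commute[of d s] by simp
        qed
        then show ?thesis
          by (intro NI[OF complex_vector.subspace_0[OF sub]]) simp
      qed
    qed
    show "complex_vector.subspace N"
    proof (rule complex_vector.subspaceI)
      show "0 \<in> N"
        by (rule NI[OF complex_vector.subspace_0[OF sub]]) simp
    next
      fix u v assume "u \<in> N" "v \<in> N"
      then obtain p q where pq: "p \<in> ?S" "q \<in> ?S" "\<forall>s\<in>?S. cinner (u - p) s = 0"
        "\<forall>s\<in>?S. cinner (v - q) s = 0"
        unfolding N_def by blast
      show "u + v \<in> N"
      proof (rule NI[OF complex_vector.subspace_add[OF sub pq(1,2)]])
        fix s assume "s \<in> ?S"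
        then have "cinner (u - p) s = 0" "cinner (v - q) s = 0"
          using pq by auto
        then show "cinner (u + v - (p + q)) s = 0"
          by (simp add: cinner_simps)
      qed
    next
      fix c u assume "u \<in> N"
      then obtain p where p: "p \<in> ?S" "\<forall>s\<in>?S. cinner (u - p) s = 0"
        unfolding N_def by blast
      show "c *\<^sub>C u \<in> N"
      proof (rule NI[OF complex_vector.subspace_scale[OF sub p(1)]])
        fix s assume "s \<in> ?S"
        then have "cinner (u - p) s = 0"
          using p by auto
        then show "cinner (c *\<^sub>C u - c *\<^sub>C p) s = 0"
          by (simp add: cinner_simps)
      qed
    qed
  qed
  moreover obtain f where f: "\<And>n. f n \<in> cspan D" "f \<longlonglongrightarrow> v"
    using dense closure_sequential by blast
  ultimately have "f n \<in> N" for n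
    by blast
  then have "\<exists>p\<in>?S. \<forall>s\<in>?S. cinner (f n - p) s = 0" for n
    unfolding N_def by simp
  then show ?thesis
    by (rule orthogonal_split_closed[OF sub closed_closure _ f(2)])
qed

lemma orth_proj_eqI:
  assumes S: "complex_vector.subspace S" and p: "p \<in> S" "\<And>s. s \<in> S \<Longrightarrow> cinner (u - p) s = 0"
  shows "orth_proj S u = p"
  unfolding orth_proj_def
proof (rule the_equality)
  fix q assume q: "q \<in> S \<and> (\<forall>s\<in>S. cinner (u - q) s = 0)"
  then have "p - q \<in> S"
    using p(1) by (intro complex_vector.subspace_diff S) auto
  then have "cinner (p - q) (p - q) = 0"
    using q p(2)[of "p - q"] by (metis (no_types, lifting) cinner_diff_left diff_eq_eq eq_diff_eq add.left_neutral)
  then show "q = p" by simp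
qed (use p in auto)

lemma positive_op_orth_proj:
  assumes S: "complex_vector.subspace S"
    and ex: "\<And>u. \<exists>p\<in>S. \<forall>s\<in>S. cinner (u - p) s = 0"
  shows "positive_op (orth_proj S)"
proof -
  have P: "orth_proj S u \<in> S \<and> (\<forall>s\<in>S. cinner (u - orth_proj S u) s = 0)" for u
    using ex[of u] orth_proj_eqI[OF S] by metis
  let ?P = "orth_proj S"
  have eq: "cinner u (?P v) = cinner (?P u) (?P v)" for u v
    using P by (metis cinner_diff_left eq_iff_diff_eq_0)
  show "positive_op ?P"
  proof (rule positive_opI)
    show "bounded_clinear ?P"
    proof (rule bounded_clinearI[of _ 1])
      show "?P (u + v) = ?P u + ?P v" for u v
      proof (rule orth_proj_eqI[OF S])
        show "?P u + ?P v \<in> S"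
          using P by (intro complex_vector.subspace_add S) auto
        show "cinner (u + v - (?P u + ?P v)) s = 0" if "s \<in> S" for s
        proof -
          have "cinner (u - ?P u) s = 0" "cinner (v - ?P v) s = 0"
            using P that by auto
          then show ?thesis by (simp add: cinner_simps)
        qed
      qed
      show "?P (c *\<^sub>C u) = c *\<^sub>C ?P u" for c u
      proof (rule orth_proj_eqI[OF S])
        show "c *\<^sub>C ?P u \<in> S"
          using P by (intro complex_vector.subspace_scale S) auto
        show "cinner (c *\<^sub>C u - c *\<^sub>C ?P u) s = 0" if "s \<in> S" for s
        proof -
          have "cinner (u - ?P u) s = 0"
            using P that by auto
          then show ?thesis by (simp add: cinner_simps)
        qed
      qed
      show "norm (?P u) \<le> norm u * 1" for u
        using P[of u] by (simp add: norm_le_of_orthogonal)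
    qed
    show "cinner (?P u) v = cinner u (?P v)" for u v
      using eq[of u v] eq[of v u] by (metis cinner_commute)
    show "Re (cinner (?P u) u) \<ge> 0" for u
      using eq[of u u] cinner_commute[of "?P u" u] by (simp add: cinner_self)
  qed
qed

section \<open>The free product space\<close>

lemma bar_bar [simp]: "bar (bar \<iota>) = \<iota>"
  by (cases \<iota>) auto

lemma bar_neq [simp]: "bar \<iota> \<noteq> \<iota>" "\<iota> \<noteq> bar \<iota>"
  by (cases \<iota>; simp)+

lemma neq_iff_eq_bar: "\<kappa> \<noteq> \<iota> \<longleftrightarrow> \<kappa> = bar \<iota>"
  by (cases \<iota>; cases \<kappa>) auto

lemma letter_inner_neq_idx: "letter_idx k \<noteq> letter_idx l \<Longrightarrow> letter_inner k l = 0"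
  by (cases k; cases l) auto

locale free_product =
  fixes \<xi>1 :: "'a::complex_hilbert_space"
    and \<xi>2 :: "'b::complex_hilbert_space"
    and \<xi> :: "'h::complex_hilbert_space"
    and tens :: "('a + 'b) list \<Rightarrow> 'h"
  assumes norm_\<xi>1: "norm \<xi>1 = 1" and norm_\<xi>2: "norm \<xi>2 = 1"
    and free_product: "is_free_product \<xi>1 \<xi>2 \<xi> tens"
begin

abbreviation "RW \<equiv> reduced_words \<xi>1 \<xi>2"
abbreviation "AV \<equiv> words_avoiding \<xi>1 \<xi>2"
abbreviation "att \<equiv> attach \<xi>1 \<xi>2 tens"
abbreviation "centered \<equiv> letter_centered \<xi>1 \<xi>2"
abbreviation "\<phi> \<equiv> vacuum_state \<xi>"

lemma tens_Nil: "tens [] = \<xi>"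
  using free_product by (simp add: is_free_product_def)

lemma tens_dense: "closure (cspan (tens ` RW)) = UNIV"
  using free_product by (simp add: is_free_product_def)

lemma cinner_tens:
  "u \<in> RW \<Longrightarrow> v \<in> RW \<Longrightarrow> cinner (tens u) (tens v) =
    (if length u = length v then \<Prod>i<length u. letter_inner (u ! i) (v ! i) else 0)"
  using free_product by (simp add: is_free_product_def)

lemma cinner_\<xi>1 [simp]: "cinner \<xi>1 \<xi>1 = 1" and cinner_\<xi>2 [simp]: "cinner \<xi>2 \<xi>2 = 1"
  by (simp_all add: cinner_self norm_\<xi>1 norm_\<xi>2)

lemma Nil_RW [simp]: "[] \<in> RW"
  by (simp add: reduced_words_def)

lemma Nil_AV [simp]: "[] \<in> AV \<iota>"
  by (simp add: words_avoiding_def)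

lemma AV_RW: "w \<in> AV \<iota> \<Longrightarrow> w \<in> RW"
  by (simp add: words_avoiding_def)

lemma Cons_RW: "l # w \<in> RW \<longleftrightarrow> centered l \<and> w \<in> AV (letter_idx l)"
  by (cases w) (auto simp: reduced_words_def words_avoiding_def)

lemma Cons_AV: "l # w \<in> AV \<iota> \<longleftrightarrow> letter_idx l = bar \<iota> \<and> centered l \<and> w \<in> AV (bar \<iota>)"
  using Cons_RW[of l w] by (auto simp: words_avoiding_def neq_iff_eq_bar)

text \<open>The cases reflect the first tensor factor over \<open>\<H>\<^sub>\<iota>\<close>: the
  distinguished vector, which is absorbed, or a centered letter.\<close>

lemma RW_cases:
  assumes "w \<in> RW"
  obtains (avoid) "w \<in> AV \<iota>"
    | (Cons) l w' where "w = l # w'" "letter_idx l = \<iota>" "centered l" "w' \<in> AV \<iota>"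
  using assms by (cases w) (auto simp: Cons_RW words_avoiding_def)

lemma cinner_tens_Cons:
  assumes "l # w \<in> RW" "l' # w' \<in> RW"
  shows "cinner (tens (l # w)) (tens (l' # w')) = letter_inner l l' * cinner (tens w) (tens w')"
proof -
  have "w \<in> RW" "w' \<in> RW"
    using assms by (auto simp: Cons_RW AV_RW)
  then show ?thesis
    by (simp add: cinner_tens assms prod.lessThan_Suc_shift del: prod.lessThan_Suc)
qed

lemma cinner_tens_Cons_avoiding:
  assumes "l # w \<in> RW" "w' \<in> AV (letter_idx l)"
  shows "cinner (tens (l # w)) (tens w') = 0"
proof (cases w')
  case Nil
  then show ?thesis
    using assms by (simp add: cinner_tens)
next
  case (Cons k v)
  then have "letter_inner l k = 0"
    using assms(2) by (auto simp: Cons_AV intro: letter_inner_neq_idx)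
  then show ?thesis
    using assms Cons by (metis AV_RW cinner_tens_Cons mult_zero_left)
qed

lemma cinner_tens_avoiding_Cons:
  assumes "l # w \<in> RW" "w' \<in> AV (letter_idx l)"
  shows "cinner (tens w') (tens (l # w)) = 0"
  using cinner_tens_Cons_avoiding[OF assms] cinner_commute[of "tens w'" "tens (l # w)"] by simp

lemma cinner_tens_neq_length:
  "u \<in> RW \<Longrightarrow> v \<in> RW \<Longrightarrow> length u \<noteq> length v \<Longrightarrow> cinner (tens u) (tens v) = 0"
  by (simp add: cinner_tens)

lemma cinner_\<xi>: "cinner \<xi> \<xi> = 1"
  using cinner_tens[of "[]" "[]"] by (simp add: tens_Nil)

lemma attach_centered: "centered l \<Longrightarrow> att l w = tens (l # w)"
  by (cases l) auto

text \<open>The scalar and the centered letter are fixed before the word. Besides, the two summand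
  types are hidden, so later arguments treat both indices at once.\<close>

lemma attach_expand:
  obtains c l' where "letter_idx l' = letter_idx l" "centered l'"
    "\<And>w. att l w = c *\<^sub>C tens w + tens (l' # w)"
proof (cases l)
  case (Inl u)
  show ?thesis
    by (rule that[of "Inl (u - cinner u \<xi>1 *\<^sub>C \<xi>1)" "cinner u \<xi>1"])
      (auto simp: Inl cinner_simps)
next
  case (Inr v)
  show ?thesis
    by (rule that[of "Inr (v - cinner v \<xi>2 *\<^sub>C \<xi>2)" "cinner v \<xi>2"])
      (auto simp: Inr cinner_simps)
qed

text \<open>The natural map is isometric: words starting in \<open>\<H>\<^sub>1\<close> are
  orthogonal to words avoiding it, so the mixed terms vanish and the two remaining ones add up to
  \<open>cinner u u'\<close>.\<close>

lemma cinner_attach_Inl: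
  assumes "w \<in> AV I1" "w' \<in> AV I1"
  shows "cinner (att (Inl u) w) (att (Inl u') w') = cinner u u' * cinner (tens w) (tens w')"
proof -
  have RW: "Inl (u - cinner u \<xi>1 *\<^sub>C \<xi>1) # v \<in> RW" if "v \<in> AV I1" for u v
    using that by (simp add: Cons_RW cinner_simps)
  have "cinner \<xi>1 u' = cnj (cinner u' \<xi>1)"
    by (rule cinner_commute)
  then show ?thesis
    using cinner_tens_Cons[OF RW[OF assms(1)] RW[OF assms(2)], of u u']
      cinner_tens_Cons_avoiding[OF RW[OF assms(1)], of w' u]
      cinner_tens_avoiding_Cons[OF RW[OF assms(2)], of w u'] assms
    by (simp add: cinner_simps algebra_simps)
qed

lemma cinner_attach_Inr:
  assumes "w \<in> AV I2" "w' \<in> AV I2"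
  shows "cinner (att (Inr u) w) (att (Inr u') w') = cinner u u' * cinner (tens w) (tens w')"
proof -
  have RW: "Inr (u - cinner u \<xi>2 *\<^sub>C \<xi>2) # v \<in> RW" if "v \<in> AV I2" for u v
    using that by (simp add: Cons_RW cinner_simps)
  have "cinner \<xi>2 u' = cnj (cinner u' \<xi>2)"
    by (rule cinner_commute)
  then show ?thesis
    using cinner_tens_Cons[OF RW[OF assms(1)] RW[OF assms(2)], of u u']
      cinner_tens_Cons_avoiding[OF RW[OF assms(1)], of w' u]
      cinner_tens_avoiding_Cons[OF RW[OF assms(2)], of w u'] assms
    by (simp add: cinner_simps algebra_simps)
qed

lemma attach_add:
  assumes "letter_idx l = \<iota>" "letter_idx k = \<iota>"
  obtains m where "letter_idx m = \<iota>" "\<And>w. w \<in> AV \<iota> \<Longrightarrow> att l w + att k w = att m w"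
proof (cases \<iota>)
  case I1
  then obtain u v where "l = Inl u" "k = Inl v"
    using assms by (cases l; cases k) auto
  then show ?thesis
    by (intro that[of "Inl (u + v)"])
      (use I1 linear_of_cinner_multiple(1)[OF cinner_attach_Inl, symmetric] in auto)
next
  case I2
  then obtain u v where "l = Inr u" "k = Inr v"
    using assms by (cases l; cases k) auto
  then show ?thesis
    by (intro that[of "Inr (u + v)"])
      (use I2 linear_of_cinner_multiple(1)[OF cinner_attach_Inr, symmetric] in auto)
qed

lemma attach_scale:
  assumes "letter_idx l = \<iota>"
  obtains m where "letter_idx m = \<iota>" "\<And>w. w \<in> AV \<iota> \<Longrightarrow> c *\<^sub>C att l w = att m w"
proof (cases \<iota>)
  case I1
  then obtain u where "l = Inl u"
    using assms by (cases l) auto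
  then show ?thesis
    by (intro that[of "Inl (c *\<^sub>C u)"])
      (use I1 linear_of_cinner_multiple(2)[OF cinner_attach_Inl, symmetric] in auto)
next
  case I2
  then obtain u where "l = Inr u"
    using assms by (cases l) auto
  then show ?thesis
    by (intro that[of "Inr (c *\<^sub>C u)"])
      (use I2 linear_of_cinner_multiple(2)[OF cinner_attach_Inr, symmetric] in auto)
qed

primrec vacuum_letter :: "idx \<Rightarrow> 'a + 'b" where
  "vacuum_letter I1 = Inl \<xi>1"
| "vacuum_letter I2 = Inr \<xi>2"

lemma letter_idx_vacuum [simp]: "letter_idx (vacuum_letter \<iota>) = \<iota>"
  by (cases \<iota>) auto

text \<open>The centered part of the distinguished vector is 0. That a word with first letter 0 has
  tensor 0 is not a convention but follows from its vanishing norm.\<close>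

lemma attach_vacuum:
  assumes "w \<in> AV \<iota>"
  shows "att (vacuum_letter \<iota>) w = tens w"
proof -
  have "cinner (tens (l # w)) (tens (l # w)) = 0"
    if "letter_inner l l = 0" "letter_idx l = \<iota>" "centered l" for l
    using assms that cinner_tens_Cons[of l w l w] by (simp add: Cons_RW)
  from this[of "Inl 0"] this[of "Inr 0"] show ?thesis
    using complex_vector.scale_one[of "tens w"] complex_vector.scale_one[of \<xi>1]
      complex_vector.scale_one[of \<xi>2] by (cases \<iota>) auto
qed

lemma attach_dense: "closure (cspan {att l w |l w. letter_idx l = \<iota> \<and> w \<in> AV \<iota>}) = UNIV"
proof -
  have "tens ` RW \<subseteq> {att l w |l w. letter_idx l = \<iota> \<and> w \<in> AV \<iota>}"
  proof clarify
    fix w assume "w \<in> RW"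
    then show "\<exists>l w'. tens w = att l w' \<and> letter_idx l = \<iota> \<and> w' \<in> AV \<iota>"
    proof (cases rule: RW_cases[where \<iota> = \<iota>])
      case avoid
      then show ?thesis
        using attach_vacuum letter_idx_vacuum by metis
    next
      case (Cons l w')
      then show ?thesis
        using attach_centered by metis
    qed
  qed
  then show ?thesis
    using closure_mono[OF complex_vector.span_mono] tens_dense by blast
qed

text \<open>The operators \<open>a \<otimes> 1\<close> with respect to the decomposition of \<open>\<H>\<close> over \<open>\<H>\<^sub>\<iota>\<close>: the letter
  replacing \<open>l\<close> must not depend on the word \<open>w\<close>.\<close>

definition ampliated :: "idx \<Rightarrow> ('h \<Rightarrow> 'h) \<Rightarrow> bool" where
  "ampliated \<iota> A \<longleftrightarrow> (\<forall>l. letter_idx l = \<iota> \<longrightarrow>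
    (\<exists>l'. letter_idx l' = \<iota> \<and> (\<forall>w\<in>AV \<iota>. A (att l w) = att l' w)))"

text \<open>The ampliation lemma applies with \<open>tens\<close> itself as second tensor factor,
  which resolves the definite description in \<open>free_rep1\<close>. Later arguments use
  boundedness and \<open>ampliated\<close> instead of that description.\<close>

lemma free_rep1_ampliated:
  assumes "bounded_clinear a"
  shows "bounded_clinear (free_rep1 \<xi>1 \<xi>2 tens a)" "ampliated I1 (free_rep1 \<xi>1 \<xi>2 tens a)"
proof -
  have idx: "letter_idx l = I1 \<longleftrightarrow> (\<exists>u. l = Inl u)" for l :: "'a + 'b"
    by (cases l) auto
  have set_eq: "{att (Inl u) w |u w. w \<in> AV I1} = {att l w |l w. letter_idx l = I1 \<and> w \<in> AV I1}"
    unfolding idx by blast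
  have "\<exists>!A. bounded_clinear A \<and> (\<forall>u. \<forall>w\<in>AV I1. A (att (Inl u) w) = att (Inl (a u)) w)"
    by (rule ampliation_ex1[where \<tau> = tens, OF cinner_attach_Inl _ assms])
      (unfold set_eq attach_dense, auto)
  from theI'[OF this] have *: "bounded_clinear (free_rep1 \<xi>1 \<xi>2 tens a)"
    "\<And>u w. w \<in> AV I1 \<Longrightarrow> free_rep1 \<xi>1 \<xi>2 tens a (att (Inl u) w) = att (Inl (a u)) w"
    unfolding free_rep1_def by blast+
  show "bounded_clinear (free_rep1 \<xi>1 \<xi>2 tens a)" by fact
  show "ampliated I1 (free_rep1 \<xi>1 \<xi>2 tens a)"
    unfolding ampliated_def
  proof (intro allI impI)
    fix l :: "'a + 'b" assume "letter_idx l = I1"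
    then obtain u where "l = Inl u" by (cases l) auto
    then show "\<exists>l'. letter_idx l' = I1 \<and> (\<forall>w\<in>AV I1. free_rep1 \<xi>1 \<xi>2 tens a (att l w) = att l' w)"
      using *(2) by (intro exI[of _ "Inl (a u)"]) simp
  qed
qed

lemma free_rep2_ampliated:
  assumes "bounded_clinear a"
  shows "bounded_clinear (free_rep2 \<xi>1 \<xi>2 tens a)" "ampliated I2 (free_rep2 \<xi>1 \<xi>2 tens a)"
proof -
  have idx: "letter_idx l = I2 \<longleftrightarrow> (\<exists>u. l = Inr u)" for l :: "'a + 'b"
    by (cases l) auto
  have set_eq: "{att (Inr u) w |u w. w \<in> AV I2} = {att l w |l w. letter_idx l = I2 \<and> w \<in> AV I2}"
    unfolding idx by blast
  have "\<exists>!A. bounded_clinear A \<and> (\<forall>u. \<forall>w\<in>AV I2. A (att (Inr u) w) = att (Inr (a u)) w)"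
    by (rule ampliation_ex1[where \<tau> = tens, OF cinner_attach_Inr _ assms])
      (unfold set_eq attach_dense, auto)
  from theI'[OF this] have *: "bounded_clinear (free_rep2 \<xi>1 \<xi>2 tens a)"
    "\<And>u w. w \<in> AV I2 \<Longrightarrow> free_rep2 \<xi>1 \<xi>2 tens a (att (Inr u) w) = att (Inr (a u)) w"
    unfolding free_rep2_def by blast+
  show "bounded_clinear (free_rep2 \<xi>1 \<xi>2 tens a)" by fact
  show "ampliated I2 (free_rep2 \<xi>1 \<xi>2 tens a)"
    unfolding ampliated_def
  proof (intro allI impI)
    fix l :: "'a + 'b" assume "letter_idx l = I2"
    then obtain u where "l = Inr u" by (cases l) auto
    then show "\<exists>l'. letter_idx l' = I2 \<and> (\<forall>w\<in>AV I2. free_rep2 \<xi>1 \<xi>2 tens a (att l w) = att l' w)"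
      using *(2) by (intro exI[of _ "Inr (a u)"]) simp
  qed
qed

lemma ampliated_id: "ampliated \<iota> id"
  by (auto simp: ampliated_def)

lemma ampliated_comp:
  assumes "ampliated \<iota> A" "ampliated \<iota> B"
  shows "ampliated \<iota> (A \<circ> B)"
  unfolding ampliated_def
proof (intro allI impI)
  fix l :: "'a + 'b" assume l: "letter_idx l = \<iota>"
  obtain l1 where l1: "letter_idx l1 = \<iota>" "\<And>w. w \<in> AV \<iota> \<Longrightarrow> B (att l w) = att l1 w"
    using assms(2) l unfolding ampliated_def by blast
  obtain l2 where l2: "letter_idx l2 = \<iota>" "\<And>w. w \<in> AV \<iota> \<Longrightarrow> A (att l1 w) = att l2 w"
    using assms(1) l1(1) unfolding ampliated_def by blast
  show "\<exists>l'. letter_idx l' = \<iota> \<and> (\<forall>w\<in>AV \<iota>. (A \<circ> B) (att l w) = att l' w)"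
    using l1 l2 by (intro exI[of _ l2]) simp
qed

lemma ampliated_plus:
  assumes "ampliated \<iota> A" "ampliated \<iota> B"
  shows "ampliated \<iota> (A + B)"
  unfolding ampliated_def
proof (intro allI impI)
  fix l :: "'a + 'b" assume l: "letter_idx l = \<iota>"
  obtain l1 where l1: "letter_idx l1 = \<iota>" "\<And>w. w \<in> AV \<iota> \<Longrightarrow> A (att l w) = att l1 w"
    using assms(1) l unfolding ampliated_def by blast
  obtain l2 where l2: "letter_idx l2 = \<iota>" "\<And>w. w \<in> AV \<iota> \<Longrightarrow> B (att l w) = att l2 w"
    using assms(2) l unfolding ampliated_def by blast
  obtain m where "letter_idx m = \<iota>" "\<And>w. w \<in> AV \<iota> \<Longrightarrow> att l1 w + att l2 w = att m w"
    using attach_add[OF l1(1) l2(1)] by blast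
  then show "\<exists>l'. letter_idx l' = \<iota> \<and> (\<forall>w\<in>AV \<iota>. (A + B) (att l w) = att l' w)"
    using l1(2) l2(2) by (intro exI[of _ m]) simp
qed

lemma ampliated_scale:
  assumes "ampliated \<iota> A"
  shows "ampliated \<iota> (\<lambda>u. c *\<^sub>C A u)"
  unfolding ampliated_def
proof (intro allI impI)
  fix l :: "'a + 'b" assume l: "letter_idx l = \<iota>"
  obtain l1 where l1: "letter_idx l1 = \<iota>" "\<And>w. w \<in> AV \<iota> \<Longrightarrow> A (att l w) = att l1 w"
    using assms l unfolding ampliated_def by blast
  obtain m where "letter_idx m = \<iota>" "\<And>w. w \<in> AV \<iota> \<Longrightarrow> c *\<^sub>C att l1 w = att m w"
    using attach_scale[OF l1(1)] by blast
  then show "\<exists>l'. letter_idx l' = \<iota> \<and> (\<forall>w\<in>AV \<iota>. c *\<^sub>C A (att l w) = att l' w)"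
    using l1(2) by (intro exI[of _ m]) simp
qed

lemma generated_algebra_ampliated:
  assumes "ampliated \<iota> X" "A \<in> generated_algebra {id, X}"
  shows "ampliated \<iota> A"
  using assms(2)
proof induction
  case (generator A)
  then show ?case using assms(1) ampliated_id by blast
qed (intro ampliated_plus ampliated_scale ampliated_comp; assumption)+

text \<open>It is essential that \<open>c\<close> and \<open>l'\<close> precede the quantifier over
  \<open>w\<close>: the shift argument compares the action on a word with the action on a longer
  word using the same pair.\<close>

lemma ampliated_attach:
  assumes "ampliated \<iota> A" "letter_idx l = \<iota>"
  obtains c l' where "letter_idx l' = \<iota>" "centered l'"
    "\<And>w. w \<in> AV \<iota> \<Longrightarrow> A (att l w) = c *\<^sub>C tens w + tens (l' # w)"
proof -
  obtain k where k: "letter_idx k = \<iota>" "\<And>w. w \<in> AV \<iota> \<Longrightarrow> A (att l w) = att k w"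
    using assms unfolding ampliated_def by blast
  obtain c l' where "letter_idx l' = letter_idx k" "centered l'"
    "\<And>w. att k w = c *\<^sub>C tens w + tens (l' # w)"
    by (rule attach_expand[of k]) (rule that)
  with k show ?thesis
    by (intro that[of l' c]) simp_all
qed

lemma ampliated_tens:
  assumes "ampliated \<iota> A"
  obtains c l' where "letter_idx l' = \<iota>" "centered l'"
    "\<And>w. w \<in> AV \<iota> \<Longrightarrow> A (tens w) = c *\<^sub>C tens w + tens (l' # w)"
proof (rule ampliated_attach[OF assms letter_idx_vacuum])
  fix c l' assume a: "letter_idx l' = \<iota>" "centered l'"
    "\<And>w. w \<in> AV \<iota> \<Longrightarrow> A (att (vacuum_letter \<iota>) w) = c *\<^sub>C tens w + tens (l' # w)"
  show thesis
    by (rule that[OF a(1,2), of c]) (use a(3) in \<open>simp add: attach_vacuum\<close>)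
qed

lemma ampliated_tens_Cons:
  assumes "ampliated \<iota> A" "letter_idx l = \<iota>" "centered l"
  obtains c l' where "letter_idx l' = \<iota>" "centered l'"
    "\<And>w. w \<in> AV \<iota> \<Longrightarrow> A (tens (l # w)) = c *\<^sub>C tens w + tens (l' # w)"
proof (rule ampliated_attach[OF assms(1,2)])
  fix c l' assume a: "letter_idx l' = \<iota>" "centered l'"
    "\<And>w. w \<in> AV \<iota> \<Longrightarrow> A (att l w) = c *\<^sub>C tens w + tens (l' # w)"
  show thesis
    by (rule that[OF a(1,2), of c]) (use a(3) in \<open>simp add: attach_centered[OF assms(3)]\<close>)
qed

definition bottom_word :: "idx \<Rightarrow> ('a + 'b) list \<Rightarrow> bool" where
  "bottom_word \<iota> w \<longleftrightarrow> w = [] \<or> (\<exists>l. w = [l] \<and> letter_idx l = \<iota>)"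

lemma word_space_split:
  "\<exists>p\<in>word_space \<xi>1 \<xi>2 tens n \<iota>. \<forall>s\<in>word_space \<xi>1 \<xi>2 tens n \<iota>. cinner (u - p) s = 0"
  if n: "n \<le> 1"
  unfolding word_space_def
proof (rule orthogonal_split_ex[OF tens_dense])
  fix d b
  assume "d \<in> tens ` RW" "b \<in> tens ` {w \<in> AV \<iota>. length w = n}"
    and ne: "d \<notin> tens ` {w \<in> AV \<iota>. length w = n}"
  then obtain w v where w: "d = tens w" "w \<in> RW" and v: "b = tens v" "v \<in> AV \<iota>" "length v = n"
    by blast
  show "cinner b d = 0"
  proof (cases "length w = n")
    case False
    then show ?thesis
      using w v by (simp add: cinner_tens_neq_length AV_RW)
  next
    case True
    with w ne have "w \<notin> AV \<iota>" by blast
    then obtain l where l: "w = [l]" "letter_idx l = \<iota>"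
      using w(2) True n by (cases w) (auto simp: words_avoiding_def)
    then show ?thesis
      using cinner_tens_avoiding_Cons[of l "[]" v] w v by simp
  qed
qed

lemma
  shows level_proj_tens: "w \<in> RW \<Longrightarrow> level_proj \<xi>1 \<xi>2 tens \<iota> 1 (tens w) = (if bottom_word \<iota> w then tens w else 0)"
    and positive_op_level_proj: "positive_op (level_proj \<xi>1 \<xi>2 tens \<iota> 1)"
proof -
  define S0 where "S0 = word_space \<xi>1 \<xi>2 tens 0 \<iota>"
  define S1 where "S1 = word_space \<xi>1 \<xi>2 tens 1 (bar \<iota>)"
  define K where "K = {u + v |u v. u \<in> S0 \<and> v \<in> S1}"
  have P: "level_proj \<xi>1 \<xi>2 tens \<iota> 1 = orth_proj K"
    by (simp add: level_proj_def K_def S0_def S1_def)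
  have sub0: "complex_vector.subspace S0" and sub1: "complex_vector.subspace S1"
    unfolding S0_def S1_def word_space_def by (rule subspace_closure_cspan)+
  have sub: "complex_vector.subspace K"
    unfolding K_def by (rule complex_vector.subspace_sums[OF sub0 sub1])
  have gen0: "tens w \<in> S0" if "w \<in> AV \<iota>" "length w = 0" for w
    unfolding S0_def word_space_def by (rule closure_cspan_base) (use that in blast)
  have gen1: "tens w \<in> S1" if "w \<in> AV (bar \<iota>)" "length w = 1" for w
    unfolding S1_def word_space_def by (rule closure_cspan_base) (use that in blast)
  have orth0: "cinner s v = 0"
    if "\<And>w. w \<in> AV \<iota> \<Longrightarrow> length w = 0 \<Longrightarrow> cinner (tens w) v = 0" "s \<in> S0" for s v
    using that(2) unfolding S0_def word_space_def
    by (rule cinner_closure_cspan_eq_0[rotated]) (use that(1) in blast)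
  have orth1: "cinner s v = 0"
    if "\<And>w. w \<in> AV (bar \<iota>) \<Longrightarrow> length w = 1 \<Longrightarrow> cinner (tens w) v = 0" "s \<in> S1" for s v
    using that(2) unfolding S1_def word_space_def
    by (rule cinner_closure_cspan_eq_0[rotated]) (use that(1) in blast)
  have S10: "cinner s1 s0 = 0" if "s1 \<in> S1" "s0 \<in> S0" for s0 s1
  proof (rule orth1[OF _ that(1)])
    fix w assume w: "w \<in> AV (bar \<iota>)" "length w = 1"
    have "cinner s0 (tens w) = 0"
      by (rule orth0[OF _ that(2)]) (use w AV_RW in \<open>auto intro!: cinner_tens_neq_length\<close>)
    then show "cinner (tens w) s0 = 0"
      using cinner_commute[of "tens w" s0] by simp
  qed
  have S01: "cinner s0 s1 = 0" if "s1 \<in> S1" "s0 \<in> S0" for s0 s1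
    using S10[OF that] cinner_commute[of s0 s1] by simp
  have ex: "\<exists>p\<in>K. \<forall>s\<in>K. cinner (u - p) s = 0" for u
  proof -
    have "\<exists>p\<in>S0. \<forall>s\<in>S0. cinner (u - p) s = 0"
      unfolding S0_def by (rule word_space_split) simp
    then obtain p0 where p0: "p0 \<in> S0" "\<And>s. s \<in> S0 \<Longrightarrow> cinner (u - p0) s = 0"
      by blast
    have "\<exists>p\<in>S1. \<forall>s\<in>S1. cinner (u - p) s = 0"
      unfolding S1_def by (rule word_space_split) simp
    then obtain p1 where p1: "p1 \<in> S1" "\<And>s. s \<in> S1 \<Longrightarrow> cinner (u - p1) s = 0"
      by blast
    show ?thesis
    \<comment> \<open>The two summands are orthogonal to each other, so the projection onto their
      sum is the sum of the projections.\<close>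
    proof (intro bexI ballI)
      show "p0 + p1 \<in> K"
        using p0 p1 unfolding K_def by blast
      fix s assume "s \<in> K"
      then obtain s0 s1 where s: "s = s0 + s1" "s0 \<in> S0" "s1 \<in> S1"
        unfolding K_def by blast
      have "cinner (u - (p0 + p1)) s =
          cinner (u - p0) s0 - cinner p1 s0 + (cinner (u - p1) s1 - cinner p0 s1)"
        by (simp add: s cinner_simps)
      then show "cinner (u - (p0 + p1)) s = 0"
        using p0 p1 s S10 S01 by simp
    qed
  qed
  show "positive_op (level_proj \<xi>1 \<xi>2 tens \<iota> 1)"
    unfolding P by (rule positive_op_orth_proj[OF sub ex])
  assume assms: "w \<in> RW"
  show "level_proj \<xi>1 \<xi>2 tens \<iota> 1 (tens w) = (if bottom_word \<iota> w then tens w else 0)"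
  proof (cases "bottom_word \<iota> w")
    case True
    have "tens w \<in> K"
    proof (cases "w = []")
      case True
      then have "tens w + 0 \<in> K"
        unfolding K_def using gen0 complex_vector.subspace_0[OF sub1] by fastforce
      then show ?thesis by simp
    next
      case False
      then obtain l where "w = [l]" "letter_idx l = \<iota>"
        using \<open>bottom_word \<iota> w\<close> by (auto simp: bottom_word_def)
      then have "tens w \<in> S1"
        using assms by (intro gen1) (auto simp: Cons_RW Cons_AV)
      then have "0 + tens w \<in> K"
        unfolding K_def using complex_vector.subspace_0[OF sub0] by blast
      then show ?thesis by simp
    qed
    then show ?thesis
      unfolding P using True by (auto intro!: orth_proj_eqI[OF sub])
  next
    case False
    have "cinner (tens w) s = 0" if sK: "s \<in> K" for s
    proof -
      obtain s0 s1 where s: "s = s0 + s1" "s0 \<in> S0" "s1 \<in> S1"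
        using sK unfolding K_def by blast
      have "cinner s0 (tens w) = 0"
        by (rule orth0[OF _ s(2)])
          (use assms False AV_RW in \<open>auto simp: bottom_word_def intro!: cinner_tens_neq_length\<close>)
      moreover have "cinner s1 (tens w) = 0"
      proof (rule orth1[OF _ s(3)])
        fix v assume v: "v \<in> AV (bar \<iota>)" "length v = 1"
        then obtain k where k: "v = [k]" "letter_idx k = \<iota>" "centered k"
          by (cases v) (auto simp: Cons_AV)
        have "w \<in> AV \<iota> \<or> length w \<noteq> 1"
          using False assms by (cases w) (auto simp: bottom_word_def words_avoiding_def)
        then show "cinner (tens v) (tens w) = 0"
          using cinner_tens_Cons_avoiding[of k "[]" w] k assms v cinner_tens_neq_length[of v w] AV_RW
          by (auto simp: Cons_RW)
      qed
      ultimately have "cinner s (tens w) = 0"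
        by (simp add: s cinner_add_left)
      then show ?thesis
        using cinner_commute[of "tens w" s] by simp
    qed
    then show ?thesis
      unfolding P using False complex_vector.subspace_0[OF sub]
      by (auto intro!: orth_proj_eqI[OF sub])
  qed
qed

end

section \<open>The trace property\<close>

lemma vacuum_state_plus: "vacuum_state \<xi> (A + B) = vacuum_state \<xi> A + vacuum_state \<xi> B"
  by (simp add: vacuum_state_def cinner_add_left)

lemma vacuum_state_scale: "vacuum_state \<xi> (\<lambda>u. c *\<^sub>C A u) = c * vacuum_state \<xi> A"
  by (simp add: vacuum_state_def cinner_scaleC_left)

lemma distribution_cong:
  assumes "\<And>n. \<phi> (A ^^ n) = \<phi> (B ^^ n)"
  shows "distribution \<phi> A = distribution \<phi> B"
  by (rule ext) (simp add: distribution_def assms)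

text \<open>Freeness enters through \<open>ampliated\<close>, which treats the two variables
  symmetrically.\<close>

locale free_pair = free_product +
  fixes X :: "idx \<Rightarrow> 'c \<Rightarrow> 'c"
  assumes positive_X: "\<And>\<iota>. positive_op (X \<iota>)" and ampliated_X: "\<And>\<iota>. ampliated \<iota> (X \<iota>)"
begin

lemmas bounded_clinear_X = positive_op_bounded_clinear[OF positive_X]

lemma vacuum_state_id: "\<phi> id = 1"
  by (simp add: vacuum_state_def cinner_\<xi>)

text \<open>The scalar is the same for every avoiding word, so the empty word identifies it as
  \<open>\<phi> A\<close>. A centered element therefore only prepends a letter.\<close>

lemma ampliated_tens_vacuum:
  assumes "ampliated \<iota> A"
  obtains l' where "letter_idx l' = \<iota>" "centered l'"
    "\<And>w. w \<in> AV \<iota> \<Longrightarrow> A (tens w) = \<phi> A *\<^sub>C tens w + tens (l' # w)"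
proof (rule ampliated_tens[OF assms])
  fix c l'
  assume l': "letter_idx l' = \<iota>" "centered l'"
    and A: "\<And>w. w \<in> AV \<iota> \<Longrightarrow> A (tens w) = c *\<^sub>C tens w + tens (l' # w)"
  have "cinner (tens [l']) (tens []) = 0"
    using l' by (intro cinner_tens_neq_length) (auto simp: Cons_RW)
  then have "\<phi> A = c"
    using A[of "[]"] by (simp add: vacuum_state_def tens_Nil cinner_simps cinner_\<xi>)
  then show thesis
    using that l' A by simp
qed

section \<open>Centered polynomials and alternating products\<close>

abbreviation poly_alg :: "idx \<Rightarrow> ('c \<Rightarrow> 'c) set" where
  "poly_alg \<iota> \<equiv> generated_algebra {id, X \<iota>}"

lemma poly_alg_bounded_clinear: "A \<in> poly_alg \<iota> \<Longrightarrow> bounded_clinear A"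
  by (rule generated_algebra_bounded_clinear[of "{id, X \<iota>}"])
    (auto intro: bounded_clinear_ident bounded_clinear_X)

lemma poly_alg_ampliated: "A \<in> poly_alg \<iota> \<Longrightarrow> ampliated \<iota> A"
  by (rule generated_algebra_ampliated[OF ampliated_X])

lemma poly_alg_id: "id \<in> poly_alg \<iota>"
  by (rule generated_algebra.generator) simp

lemma poly_alg_commute:
  assumes A: "A \<in> poly_alg \<iota>" and B: "B \<in> poly_alg \<iota>"
  shows "A \<circ> B = B \<circ> A"
proof
  have "X \<iota> (B u) = B (X \<iota> u)" for u
    by (rule generated_algebra_commute[OF bounded_clinear_X _ B, symmetric]) auto
  then have "A (B u) = B (A u)" for u
    by (intro generated_algebra_commute[OF poly_alg_bounded_clinear[OF B] _ A]) auto
  then show "(A \<circ> B) u = (B \<circ> A) u" for u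
    by simp
qed

definition centered_alg :: "idx \<Rightarrow> ('c \<Rightarrow> 'c) set" where
  "centered_alg \<iota> = {A \<in> poly_alg \<iota>. \<phi> A = 0}"

definition center :: "('c \<Rightarrow> 'c) \<Rightarrow> 'c \<Rightarrow> 'c" where
  "center A = A + (\<lambda>u. (- \<phi> A) *\<^sub>C id u)"

lemma center_centered_alg: "A \<in> poly_alg \<iota> \<Longrightarrow> center A \<in> centered_alg \<iota>"
  unfolding centered_alg_def center_def
  by (simp add: vacuum_state_plus vacuum_state_scale vacuum_state_id generated_algebra.add
      generated_algebra.scale poly_alg_id del: id_apply complex_vector.scale_minus_left)

lemma center_apply: "A u = center A u + \<phi> A *\<^sub>C u"
  by (simp add: center_def)

text \<open>The indices of the first and of the last factor are both recorded, because the trace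
  property multiplies on either side.\<close>

inductive alternating :: "idx \<Rightarrow> idx \<Rightarrow> ('c \<Rightarrow> 'c) \<Rightarrow> bool" where
  single: "A \<in> centered_alg \<iota> \<Longrightarrow> alternating \<iota> \<iota> A"
| Cons: "A \<in> centered_alg \<iota> \<Longrightarrow> alternating (bar \<iota>) \<kappa> B \<Longrightarrow> alternating \<iota> \<kappa> (A \<circ> B)"

lemma alternating_bounded_clinear: "alternating \<iota> \<kappa> B \<Longrightarrow> bounded_clinear B"
proof (induction rule: alternating.induct)
  case (single A \<iota>)
  then show ?case
    by (intro poly_alg_bounded_clinear[of A \<iota>]) (simp add: centered_alg_def)
next
  case (Cons A \<iota> \<kappa> B)
  then show ?case
    by (intro bounded_clinear_comp poly_alg_bounded_clinear[of A \<iota>]) (simp_all add: centered_alg_def)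
qed

text \<open>Applied to the vacuum, each centered factor prepends one letter of its index, and
  alternation keeps the word reduced. Orthogonality of the resulting nonempty word to
  \<open>\<xi>\<close> is the freeness of the two variables.\<close>

lemma alternating_vacuum:
  "alternating \<iota> \<kappa> B \<Longrightarrow> \<exists>l w. B \<xi> = tens (l # w) \<and> l # w \<in> RW \<and> letter_idx l = \<iota>"
proof (induction rule: alternating.induct)
  case (single A \<iota>)
  then have "ampliated \<iota> A" "\<phi> A = 0"
    by (auto simp: centered_alg_def poly_alg_ampliated)
  then obtain l' where l': "letter_idx l' = \<iota>" "centered l'"
    "\<And>w. w \<in> AV \<iota> \<Longrightarrow> A (tens w) = 0 *\<^sub>C tens w + tens (l' # w)"
    using ampliated_tens_vacuum[of \<iota> A] by metis
  then show ?case
    using l'(3)[of "[]"] by (intro exI[of _ l'] exI[of _ "[]"]) (simp add: tens_Nil Cons_RW)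
next
  case (Cons A \<iota> \<kappa> B)
  then obtain l w where w: "B \<xi> = tens (l # w)" "l # w \<in> RW" "letter_idx l = bar \<iota>"
    by blast
  have AV: "l # w \<in> AV \<iota>"
    using w by (simp add: Cons_AV Cons_RW)
  from Cons have "ampliated \<iota> A" "\<phi> A = 0"
    by (auto simp: centered_alg_def poly_alg_ampliated)
  then obtain l' where l': "letter_idx l' = \<iota>" "centered l'"
    "\<And>w. w \<in> AV \<iota> \<Longrightarrow> A (tens w) = 0 *\<^sub>C tens w + tens (l' # w)"
    using ampliated_tens_vacuum[of \<iota> A] by metis
  then show ?case
    using l'(3)[OF AV] w AV
    by (intro exI[of _ l'] exI[of _ "l # w"]) (simp add: Cons_RW[of l'])
qed

lemma vacuum_state_alternating: "alternating \<iota> \<kappa> B \<Longrightarrow> \<phi> B = 0"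
  using alternating_vacuum[of \<iota> \<kappa> B] cinner_tens_neq_length[of _ "[]"]
  by (auto simp: vacuum_state_def tens_Nil)

lemma alternating_snoc:
  "alternating \<iota> \<kappa> B \<Longrightarrow> A \<in> centered_alg (bar \<kappa>) \<Longrightarrow> alternating \<iota> (bar \<kappa>) (B \<circ> A)"
  by (induction rule: alternating.induct)
    (auto simp: comp_assoc intro: alternating.intros)

lemma alternating_cases_last:
  assumes "alternating \<iota> \<kappa> B"
  shows "B \<in> centered_alg \<kappa> \<and> \<iota> = \<kappa> \<or>
    (\<exists>B' A. B = B' \<circ> A \<and> alternating \<iota> (bar \<kappa>) B' \<and> A \<in> centered_alg \<kappa>)"
  using assms
proof (induction rule: alternating.induct)
  case (single A \<iota>)
  then show ?case by simp
next
  case (Cons A \<iota> \<kappa> B)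
  from Cons.IH show ?case
  proof
    assume "B \<in> centered_alg \<kappa> \<and> bar \<iota> = \<kappa>"
    then have "alternating \<iota> (bar \<kappa>) A" "B \<in> centered_alg \<kappa>"
      using alternating.single[OF Cons.hyps(1)] by auto
    then show ?thesis by blast
  next
    assume "\<exists>B' A. B = B' \<circ> A \<and> alternating (bar \<iota>) (bar \<kappa>) B' \<and> A \<in> centered_alg \<kappa>"
    then obtain B' C where "B = B' \<circ> C" "alternating (bar \<iota>) (bar \<kappa>) B'" "C \<in> centered_alg \<kappa>"
      by blast
    then have "A \<circ> B = (A \<circ> B') \<circ> C" "alternating \<iota> (bar \<kappa>) (A \<circ> B')" "C \<in> centered_alg \<kappa>"
      using alternating.Cons[OF Cons.hyps(1)] by (simp_all only: comp_assoc)
    then show ?thesis by blast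
  qed
qed

text \<open>Splitting \<open>C\<close> into its centered part and a scalar gives two alternating
  products, both annihilated by \<open>\<phi>\<close>.\<close>

lemma vacuum_state_comp_alternating:
  assumes C: "C \<in> poly_alg \<iota>" and B: "alternating (bar \<iota>) \<kappa> B"
  shows "\<phi> (C \<circ> B) = 0"
proof -
  have "C \<circ> B = (center C \<circ> B) + (\<lambda>u. \<phi> C *\<^sub>C B u)"
    by (rule ext) (use center_apply in simp)
  moreover have "\<phi> (center C \<circ> B) = 0"
    by (rule vacuum_state_alternating[OF alternating.Cons[OF center_centered_alg[OF C] B]])
  ultimately show ?thesis
    using vacuum_state_alternating[OF B] by (simp only: vacuum_state_plus vacuum_state_scale) simp
qed

lemma vacuum_state_alternating_comp:
  assumes C: "C \<in> poly_alg \<kappa>" and B: "alternating \<iota> (bar \<kappa>) B"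
  shows "\<phi> (B \<circ> C) = 0"
proof -
  have "B \<circ> C = (B \<circ> center C) + (\<lambda>u. \<phi> C *\<^sub>C B u)"
    by (rule ext) (subst o_apply, subst center_apply[of C],
      simp add: bounded_clinear_simps[OF alternating_bounded_clinear[OF B]])
  moreover have "\<phi> (B \<circ> center C) = 0"
    using alternating_snoc[OF B, of "center C"] center_centered_alg[OF C]
    by (simp add: vacuum_state_alternating)
  ultimately show ?thesis
    using vacuum_state_alternating[OF B] by (simp only: vacuum_state_plus vacuum_state_scale) simp
qed

text \<open>Factors of equal index commute; in the other cases both sides are 0, because an adjacent
  factor of equal index is merged with \<open>A\<close> and a nonempty alternating product survives
  beside it.\<close>

lemma vacuum_state_trace_alternating:
  assumes A: "A \<in> centered_alg \<iota>" and B: "alternating \<iota>' \<kappa> B"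
  shows "\<phi> (A \<circ> B) = \<phi> (B \<circ> A)"
proof -
  have Ap: "A \<in> poly_alg \<iota>" using A by (simp add: centered_alg_def)
  have comp: "A \<circ> C \<in> poly_alg \<iota>" "C \<circ> A \<in> poly_alg \<iota>" if "C \<in> centered_alg \<iota>" for C
    using that Ap by (auto simp: centered_alg_def simp del: o_apply intro: generated_algebra.comp)
  show ?thesis
    using B
  proof cases
    case single
    show ?thesis
    proof (cases "\<iota> = \<iota>'")
      case True
      then show ?thesis
        using poly_alg_commute[OF Ap, of B] single by (simp add: centered_alg_def)
    next
      case False
      then have "\<iota>' = bar \<iota>" "\<iota> = bar \<iota>'"
        using neq_iff_eq_bar[of \<iota>' \<iota>] by auto
      then have "alternating \<iota> \<iota>' (A \<circ> B)" "alternating \<iota>' \<iota> (B \<circ> A)"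
        using A single alternating.Cons[OF A, of \<iota>' B] alternating.Cons[of B \<iota>' \<iota> A]
          alternating.single[OF A] alternating.single[of B \<iota>'] by simp_all
      then show ?thesis
        by (simp only: vacuum_state_alternating)
    qed
  next
    case (Cons A1 B1)
    have "\<phi> (A \<circ> B) = 0"
    proof (cases "\<iota>' = \<iota>")
      case True
      then show ?thesis
        using vacuum_state_comp_alternating[OF comp(1), of A1 \<kappa> B1] Cons by (simp add: comp_assoc)
    next
      case False
      then show ?thesis
        using B by (intro vacuum_state_comp_alternating[OF Ap, of \<kappa>]) (simp add: neq_iff_eq_bar)
    qed
    moreover have "\<phi> (B \<circ> A) = 0"
    proof (cases "\<kappa> = \<iota>")
      case True
      from alternating_cases_last[OF B] show ?thesis
      proof
        \<comment> \<open>As an operator, a longer product may coincide with a single centered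
          element; commutativity then reduces the claim to the value already computed.\<close>
        assume "B \<in> centered_alg \<kappa> \<and> \<iota>' = \<kappa>"
        then have "A \<circ> B = B \<circ> A"
          using Ap True by (intro poly_alg_commute[OF Ap]) (simp add: centered_alg_def)
        then show ?thesis
          using \<open>\<phi> (A \<circ> B) = 0\<close> by simp
      next
        assume "\<exists>B' C. B = B' \<circ> C \<and> alternating \<iota>' (bar \<kappa>) B' \<and> C \<in> centered_alg \<kappa>"
        then obtain B' C where "B = B' \<circ> C" "alternating \<iota>' (bar \<iota>) B'" "C \<in> centered_alg \<iota>"
          using True by blast
        then show ?thesis
          using vacuum_state_alternating_comp[OF comp(2), of C \<iota>' B'] by (simp add: comp_assoc)
      qed
    next
      case False
      then show ?thesis
        using B by (intro vacuum_state_alternating_comp[OF Ap, of \<iota>']) (simp add: neq_iff_eq_bar)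
    qed
    ultimately show ?thesis by simp
  qed
qed

section \<open>Expansion in alternating products and the trace\<close>

inductive_set alternating_span :: "('c \<Rightarrow> 'c) set" where
  id: "id \<in> alternating_span"
| alternating: "alternating \<iota> \<kappa> B \<Longrightarrow> B \<in> alternating_span"
| add: "A \<in> alternating_span \<Longrightarrow> B \<in> alternating_span \<Longrightarrow> A + B \<in> alternating_span"
| scale: "A \<in> alternating_span \<Longrightarrow> (\<lambda>u. c *\<^sub>C A u) \<in> alternating_span"

lemma poly_alg_alternating_span:
  assumes C: "C \<in> poly_alg \<iota>"
  shows "C \<in> alternating_span"
proof -
  have "C = center C + (\<lambda>u. \<phi> C *\<^sub>C id u)"
    by (rule ext) (use center_apply in simp)
  moreover have "center C + (\<lambda>u. \<phi> C *\<^sub>C id u) \<in> alternating_span"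
    by (intro alternating_span.add alternating_span.scale alternating_span.id
        alternating_span.alternating[OF alternating.single[OF center_centered_alg[OF C]]])
  ultimately show ?thesis by simp
qed

lemma comp_alternating_span:
  assumes C: "C \<in> poly_alg \<iota>" and B: "alternating (bar \<iota>) \<kappa> B"
  shows "C \<circ> B \<in> alternating_span"
proof -
  have "C \<circ> B = (center C \<circ> B) + (\<lambda>u. \<phi> C *\<^sub>C B u)"
    by (rule ext) (use center_apply in simp)
  moreover have "(center C \<circ> B) + (\<lambda>u. \<phi> C *\<^sub>C B u) \<in> alternating_span"
    by (intro alternating_span.add alternating_span.scale alternating_span.alternating[OF B]
        alternating_span.alternating[OF alternating.Cons[OF center_centered_alg[OF C] B]])
  ultimately show ?thesis by simp
qed

text \<open>If the indices agree, \<open>A\<close> is merged with the first factor and the result is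
  centered anew; otherwise \<open>A\<close> is centered and prepended.\<close>

lemma alternating_span_left:
  assumes A: "A \<in> poly_alg \<iota>" and B: "B \<in> alternating_span"
  shows "A \<circ> B \<in> alternating_span"
  using B
proof induction
  case id
  then show ?case using poly_alg_alternating_span[OF A] by simp
next
  case (alternating \<iota>' \<kappa> B)
  show ?case
  proof (cases "\<iota>' = \<iota>")
    case False
    then show ?thesis
      using alternating by (intro comp_alternating_span[OF A, of \<kappa>]) (simp add: neq_iff_eq_bar)
  next
    case True
    from alternating show ?thesis
    proof cases
      case single
      then have "A \<circ> B \<in> poly_alg \<iota>"
        using A True by (intro generated_algebra.comp) (auto simp: centered_alg_def)
      then show ?thesis by (rule poly_alg_alternating_span)
    next
      case (Cons A1 B1)
      then have "A \<circ> A1 \<in> poly_alg \<iota>"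
        using A True by (intro generated_algebra.comp) (auto simp: centered_alg_def)
      moreover have "alternating (bar \<iota>) \<kappa> B1"
        using Cons True by simp
      ultimately have "A \<circ> A1 \<circ> B1 \<in> alternating_span"
        by (rule comp_alternating_span)
      then show ?thesis
        using Cons(1) by (simp only: comp_assoc)
    qed
  qed
next
  case (add B C)
  have "A \<circ> (B + C) = (A \<circ> B) + (A \<circ> C)"
    by (rule ext) (simp add: bounded_clinear_simps[OF poly_alg_bounded_clinear[OF A]])
  then show ?case
    using add alternating_span.add by metis
next
  case (scale B c)
  have "A \<circ> (\<lambda>u. c *\<^sub>C B u) = (\<lambda>u. c *\<^sub>C (A \<circ> B) u)"
    by (rule ext) (simp add: bounded_clinear_simps[OF poly_alg_bounded_clinear[OF A]])
  then show ?case
    using alternating_span.scale[OF scale.IH] by metis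
qed

abbreviation full_alg :: "('c \<Rightarrow> 'c) set" where
  "full_alg \<equiv> generated_algebra (range X \<union> {id})"

lemma full_alg_alternating_span:
  assumes "A \<in> full_alg"
  shows "A \<in> alternating_span"
proof -
  \<comment> \<open>Stated as invariance under left multiplication, the claim passes through
    compositions at once, with no product of two alternating elements to expand. Evaluation at
    \<open>id\<close> recovers membership.\<close>
  have "\<forall>B\<in>alternating_span. A \<circ> B \<in> alternating_span"
    using assms
  proof induction
    case (generator A)
    then obtain \<iota> where "A \<in> {id, X \<iota>}"
      by auto
    then have "A \<in> poly_alg \<iota>"
      by (rule generated_algebra.generator)
    then show ?case
      using alternating_span_left by blast
  next
    case (scale A c)
    show ?case
    proof
      fix B assume "B \<in> alternating_span"
      then have "(\<lambda>u. c *\<^sub>C (A \<circ> B) u) \<in> alternating_span"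
        using scale.IH by (intro alternating_span.scale) blast
      then show "(\<lambda>u. c *\<^sub>C A u) \<circ> B \<in> alternating_span"
        by (simp only: o_def)
    qed
  next
    case (add A C)
    show ?case
    proof
      fix B assume "B \<in> alternating_span"
      then have "(A \<circ> B) + (C \<circ> B) \<in> alternating_span"
        using add.IH by (intro alternating_span.add) blast+
      then show "(A + C) \<circ> B \<in> alternating_span"
        by (simp only: o_def plus_fun_def)
    qed
  next
    case (comp A C)
    then show ?case by (simp only: comp_assoc) blast
  qed
  then have "A \<circ> id \<in> alternating_span"
    using alternating_span.id by blast
  then show ?thesis by simp
qed

lemma poly_alg_full_alg: "A \<in> poly_alg \<iota> \<Longrightarrow> A \<in> full_alg"
  by (erule generated_algebra_mono) (auto intro!: generated_algebra.generator)

lemma vacuum_state_trace: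
  assumes A: "A \<in> poly_alg \<iota>" and B: "B \<in> full_alg"
  shows "\<phi> (A \<circ> B) = \<phi> (B \<circ> A)"
  using full_alg_alternating_span[OF B]
proof induction
  case (alternating \<iota>' \<kappa> B)
  note lin = bounded_clinear_simps[OF alternating_bounded_clinear[OF alternating]]
  have "A \<circ> B = (center A \<circ> B) + (\<lambda>u. \<phi> A *\<^sub>C B u)"
    by (rule ext) (use center_apply in simp)
  moreover have "B \<circ> A = (B \<circ> center A) + (\<lambda>u. \<phi> A *\<^sub>C B u)"
    by (rule ext) (subst o_apply, subst center_apply[of A], simp add: lin)
  ultimately show ?case
    using vacuum_state_trace_alternating[OF center_centered_alg[OF A] alternating]
    by (simp only: vacuum_state_plus)
next
  case (add B C)
  have "A \<circ> (B + C) = (A \<circ> B) + (A \<circ> C)" "(B + C) \<circ> A = (B \<circ> A) + (C \<circ> A)"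
    by (rule ext, simp add: bounded_clinear_simps[OF poly_alg_bounded_clinear[OF A]])+
  then show ?case
    using add by (simp only: vacuum_state_plus)
next
  case (scale B c)
  have "A \<circ> (\<lambda>u. c *\<^sub>C B u) = (\<lambda>u. c *\<^sub>C (A \<circ> B) u)" "(\<lambda>u. c *\<^sub>C B u) \<circ> A = (\<lambda>u. c *\<^sub>C (B \<circ> A) u)"
    by (rule ext, simp add: bounded_clinear_simps[OF poly_alg_bounded_clinear[OF A]])+
  then show ?case
    using scale by (simp only: vacuum_state_scale)
qed simp

lemma full_alg_bounded_clinear: "A \<in> full_alg \<Longrightarrow> bounded_clinear A"
  by (rule generated_algebra_bounded_clinear[of "range X \<union> {id}"])
    (auto intro: bounded_clinear_ident bounded_clinear_X)

text \<open>The square root of \<open>X \<iota>\<close> is a strong limit of elements \<open>S n\<close> of the algebra, so the trace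
  property passes to it.\<close>

lemma vacuum_state_sqrt_conjugate:
  assumes B: "B \<in> full_alg"
  shows "\<phi> (op_sqrt (X \<iota>) \<circ> B \<circ> op_sqrt (X \<iota>)) = \<phi> (B \<circ> X \<iota>)"
proof -
  define R where "R = op_sqrt (X \<iota>)"
  have R: "bounded_clinear R"
    unfolding R_def by (intro positive_op_bounded_clinear positive_op_sqrt positive_X)
  obtain S where S: "\<And>n. S n \<in> poly_alg \<iota>" "\<And>u. (\<lambda>n. S n u) \<longlonglongrightarrow> op_sqrt (X \<iota>) u"
    by (rule op_sqrt_approx[OF positive_X[of \<iota>]]) (rule that)
  note S = S[folded R_def]
  have R_trace: "\<phi> (R \<circ> C) = \<phi> (C \<circ> R)" if C: "C \<in> full_alg" for C
  proof (rule LIMSEQ_unique)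
    show "(\<lambda>n. \<phi> (S n \<circ> C)) \<longlonglongrightarrow> \<phi> (R \<circ> C)"
      unfolding vacuum_state_def o_apply by (intro tendsto_intros S)
    have "(\<lambda>n. \<phi> (C \<circ> S n)) \<longlonglongrightarrow> \<phi> (C \<circ> R)"
      unfolding vacuum_state_def o_apply
      by (intro tendsto_intros bounded_clinear_tendsto[OF full_alg_bounded_clinear[OF C]] S)
    then show "(\<lambda>n. \<phi> (S n \<circ> C)) \<longlonglongrightarrow> \<phi> (C \<circ> R)"
      by (simp only: vacuum_state_trace[OF S(1) C])
  qed
  \<comment> \<open>The element \<open>B \<circ> R\<close> need not lie in \<open>full_alg\<close>,
    so \<open>R_trace\<close> is applied to \<open>B \<circ> S n\<close>, followed by a second
    limit.\<close>
  have "\<phi> (R \<circ> B \<circ> R) = \<phi> (B \<circ> R \<circ> R)"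
  proof (rule LIMSEQ_unique)
    show "(\<lambda>n. \<phi> (R \<circ> (B \<circ> S n))) \<longlonglongrightarrow> \<phi> (R \<circ> B \<circ> R)"
      unfolding vacuum_state_def o_apply
      by (intro tendsto_intros bounded_clinear_tendsto[OF full_alg_bounded_clinear[OF B]]
          bounded_clinear_tendsto[OF R] S)
    have "(\<lambda>n. \<phi> (B \<circ> S n \<circ> R)) \<longlonglongrightarrow> \<phi> (B \<circ> R \<circ> R)"
      unfolding vacuum_state_def o_apply
      by (intro tendsto_intros bounded_clinear_tendsto[OF full_alg_bounded_clinear[OF B]] S)
    moreover have "B \<circ> S n \<in> full_alg" for n
      by (intro generated_algebra.comp B poly_alg_full_alg[OF S(1)])
    ultimately show "(\<lambda>n. \<phi> (R \<circ> (B \<circ> S n))) \<longlonglongrightarrow> \<phi> (B \<circ> R \<circ> R)"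
      by (simp only: R_trace)
  qed
  moreover have "B \<circ> R \<circ> R = B \<circ> X \<iota>"
    by (rule ext) (simp add: R_def op_sqrt_square[OF positive_X])
  ultimately show ?thesis
    by (simp add: R_def)
qed

lemma moments_sqrt_conjugate:
  "\<phi> ((op_sqrt (X \<iota>) \<circ> X \<kappa> \<circ> op_sqrt (X \<iota>)) ^^ n) = \<phi> ((X \<kappa> \<circ> X \<iota>) ^^ n)"
proof (cases n)
  case (Suc m)
  let ?R = "op_sqrt (X \<iota>)" and ?YX = "X \<kappa> \<circ> X \<iota>"
  \<comment> \<open>Adjacent roots combine to \<open>X \<iota>\<close>, leaving one root at either
    end of an element of the algebra.\<close>
  have "(?R \<circ> X \<kappa> \<circ> ?R) ^^ Suc m = ?R \<circ> (?YX ^^ m \<circ> X \<kappa>) \<circ> ?R"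
  proof (induction m)
    case (Suc m)
    have "(?R \<circ> X \<kappa> \<circ> ?R) ^^ Suc (Suc m) = (?R \<circ> X \<kappa> \<circ> ?R) \<circ> (?R \<circ> (?YX ^^ m \<circ> X \<kappa>) \<circ> ?R)"
      by (subst funpow.simps(2)) (simp only: Suc)
    also have "\<dots> = ?R \<circ> (?YX ^^ Suc m \<circ> X \<kappa>) \<circ> ?R"
      by (rule ext) (simp add: op_sqrt_square[OF positive_X])
    finally show ?case .
  qed simp
  moreover have YX: "X \<kappa> \<circ> X \<iota> \<in> full_alg"
    by (intro generated_algebra.comp generated_algebra.generator) auto
  have "?YX ^^ m \<circ> X \<kappa> \<in> full_alg"
  proof (rule generated_algebra.comp)
    show "?YX ^^ m \<in> full_alg"
    proof (induction m)
      case 0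
      then show ?case by (intro generated_algebra.generator) (auto simp: id_def)
    next
      case (Suc m)
      then show ?case unfolding funpow.simps by (rule generated_algebra.comp[OF YX])
    qed
  qed (auto intro: generated_algebra.generator)
  ultimately have "\<phi> ((?R \<circ> X \<kappa> \<circ> ?R) ^^ Suc m) = \<phi> (?YX ^^ m \<circ> X \<kappa> \<circ> X \<iota>)"
    by (simp only: vacuum_state_sqrt_conjugate)
  also have "?YX ^^ m \<circ> X \<kappa> \<circ> X \<iota> = ?YX ^^ Suc m"
    by (simp only: comp_assoc funpow_Suc_right)
  finally show ?thesis
    by (simp only: Suc)
qed simp

end

section \<open>Monotone independence\<close>

lemma cinner_eqI: "(\<And>v. cinner u v = cinner w v) \<Longrightarrow> u = w"
  using cinner_self_eq_0[of "u - w"] by (simp add: cinner_diff_left)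

context free_product
begin

lemma snoc_RW: "w @ [k] \<in> RW \<longleftrightarrow> w \<in> RW \<and> centered k \<and> (w = [] \<or> letter_idx (last w) \<noteq> letter_idx k)"
  by (auto simp: reduced_words_def successively_append_iff)

lemma tens_eqI:
  assumes "bounded_clinear A" "bounded_clinear B" "\<And>w. w \<in> RW \<Longrightarrow> A (tens w) = B (tens w)"
  shows "A = B"
  by (rule bounded_clinear_eqI[OF assms(1,2) tens_dense]) (use assms(3) in blast)

abbreviation proj :: "idx \<Rightarrow> 'h \<Rightarrow> 'h" where
  "proj \<iota> \<equiv> level_proj \<xi>1 \<xi>2 tens \<iota> 1"

lemmas bounded_clinear_proj = positive_op_bounded_clinear[OF positive_op_level_proj]

lemma proj_idem: "proj \<iota> (proj \<iota> u) = proj \<iota> u"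
proof -
  have "proj \<iota> \<circ> proj \<iota> = proj \<iota>"
    by (rule tens_eqI)
      (auto simp: level_proj_tens bounded_clinear_zero[OF bounded_clinear_proj] simp del: One_nat_def
        intro: bounded_clinear_comp bounded_clinear_proj)
  then show ?thesis by (metis o_apply)
qed

lemma proj_\<xi>: "proj \<iota> \<xi> = \<xi>"
  using level_proj_tens[of "[]" \<iota>] by (simp add: tens_Nil bottom_word_def)

text \<open>With \<open>\<H>\<close> split over \<open>\<H>\<^sub>\<iota>\<close>, the range of the
  projection is \<open>\<H>\<^sub>\<iota> \<otimes> \<xi>\<close>. The projection thus acts on the
  second tensor factor and \<open>A\<close> on the first.\<close>

lemma proj_commute:
  assumes A: "ampliated \<iota> A" "bounded_clinear A"
  shows "A (proj \<iota> u) = proj \<iota> (A u)"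
proof -
  note P = bounded_clinear_simps[OF bounded_clinear_proj[of \<iota>]]
  have "A \<circ> proj \<iota> = proj \<iota> \<circ> A"
  proof (rule tens_eqI)
    fix w assume w: "w \<in> RW"
    then show "(A \<circ> proj \<iota>) (tens w) = (proj \<iota> \<circ> A) (tens w)"
    proof (cases rule: RW_cases[where \<iota> = \<iota>])
      case avoid
      obtain c l' where l': "letter_idx l' = \<iota>" "centered l'"
        "\<And>w. w \<in> AV \<iota> \<Longrightarrow> A (tens w) = c *\<^sub>C tens w + tens (l' # w)"
        by (rule ampliated_tens[OF A(1)]) (rule that)
      have "bottom_word \<iota> (l' # w) \<longleftrightarrow> bottom_word \<iota> w"
        using avoid l' by (auto simp: bottom_word_def Cons_AV)
      then show ?thesis
        using w avoid l' by (simp add: P level_proj_tens Cons_RW bounded_clinear_zero[OF A(2)]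
            del: One_nat_def)
    next
      case (Cons l w')
      obtain c l' where l': "letter_idx l' = \<iota>" "centered l'"
        "\<And>w. w \<in> AV \<iota> \<Longrightarrow> A (tens (l # w)) = c *\<^sub>C tens w + tens (l' # w)"
        by (rule ampliated_tens_Cons[OF A(1) Cons(2,3)]) (rule that)
      have "bottom_word \<iota> (l' # w') \<longleftrightarrow> w' = []" "bottom_word \<iota> (l # w') \<longleftrightarrow> w' = []"
        "bottom_word \<iota> w' \<longleftrightarrow> w' = []"
        using Cons l' by (auto simp: bottom_word_def Cons_AV)
      then show ?thesis
        using w Cons l' by (simp add: P level_proj_tens Cons_RW AV_RW bounded_clinear_zero[OF A(2)]
            del: One_nat_def)
    qed
  qed (intro bounded_clinear_comp A bounded_clinear_proj)+
  then show ?thesis by (metis o_apply)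
qed

text \<open>\<open>shifted k h g\<close> says that \<open>g\<close> is the image of \<open>h\<close> under the right tensoring \<open>w \<mapsto> w \<otimes> k\<close>,
  for \<open>h\<close> in the algebraic span of the words not ending in the space of \<open>k\<close>.\<close>

inductive shifted :: "'a + 'b \<Rightarrow> 'h \<Rightarrow> 'h \<Rightarrow> bool" for k where
  word: "w @ [k] \<in> RW \<Longrightarrow> shifted k (tens w) (tens (w @ [k]))"
| add: "shifted k h g \<Longrightarrow> shifted k h' g' \<Longrightarrow> shifted k (h + h') (g + g')"
| scale: "shifted k h g \<Longrightarrow> shifted k (c *\<^sub>C h) (c *\<^sub>C g)"

text \<open>The operator changes only the beginning of a word, while \<open>k\<close> sits at its
  end. The excluded case is the one where \<open>k\<close> is itself the first letter and of index
  \<open>\<kappa>\<close>, so that the operator would change it.\<close>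

lemma shifted_ampliated:
  assumes A: "ampliated \<kappa> A" and wk: "w @ [k] \<in> RW" and ne: "w \<noteq> [] \<or> letter_idx k \<noteq> \<kappa>"
  shows "shifted k (A (tens w)) (A (tens (w @ [k])))"
proof -
  have "w \<in> RW" using wk snoc_RW by blast
  then show ?thesis
  proof (cases rule: RW_cases[where \<iota> = \<kappa>])
    case avoid
    obtain c l' where l': "letter_idx l' = \<kappa>" "centered l'"
      "\<And>w. w \<in> AV \<kappa> \<Longrightarrow> A (tens w) = c *\<^sub>C tens w + tens (l' # w)"
      by (rule ampliated_tens[OF A]) (rule that)
    have AV: "w @ [k] \<in> AV \<kappa>"
      using wk ne avoid by (cases w) (auto simp: words_avoiding_def)
    then have "shifted k (tens (l' # w)) (tens ((l' # w) @ [k]))"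
      using l' by (intro shifted.word) (simp add: Cons_RW)
    then show ?thesis
      unfolding l'(3)[OF avoid] l'(3)[OF AV]
      by (intro shifted.add shifted.scale shifted.word[OF wk]) simp
  next
    case (Cons l w')
    obtain c l' where l': "letter_idx l' = \<kappa>" "centered l'"
      "\<And>w. w \<in> AV \<kappa> \<Longrightarrow> A (tens (l # w)) = c *\<^sub>C tens w + tens (l' # w)"
      by (rule ampliated_tens_Cons[OF A Cons(2,3)]) (rule that)
    have AV: "w' @ [k] \<in> AV \<kappa>"
      using wk Cons by (simp add: Cons_RW)
    then have "shifted k (tens (l' # w')) (tens ((l' # w') @ [k]))"
      using l' by (intro shifted.word) (simp add: Cons_RW)
    moreover have "shifted k (tens w') (tens (w' @ [k]))"
      by (rule shifted.word[OF AV_RW[OF AV]])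
    ultimately show ?thesis
      using l'(3)[OF AV] l'(3)[OF Cons(4)] Cons(1) by (simp add: shifted.add shifted.scale)
  qed
qed

text \<open>A reduced word ending in \<open>k\<close> lies in the first level only if nothing
  precedes \<open>k\<close>, and its unshifted word only if it is empty. So both projections see
  just the coefficient of the empty word.\<close>

lemma shifted_proj:
  assumes "shifted k h g" "letter_idx k = \<iota>"
  shows "proj \<iota> h = cinner h \<xi> *\<^sub>C \<xi> \<and> proj \<iota> g = cinner h \<xi> *\<^sub>C tens [k]"
  using assms(1)
proof induction
  case (word w)
  then have RW: "w \<in> RW" using snoc_RW by blast
  show ?case
  proof (cases "w = []")
    case True
    have "bottom_word \<iota> [k]" "bottom_word \<iota> []"
      using assms(2) by (auto simp: bottom_word_def)
    then show ?thesis
      using True word by (simp add: level_proj_tens tens_Nil[symmetric] del: One_nat_def)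
        (simp add: tens_Nil cinner_\<xi>)
  next
    case False
    then have "\<not> bottom_word \<iota> w" "\<not> bottom_word \<iota> (w @ [k])"
      using word assms(2) by (auto simp: bottom_word_def snoc_RW)
    moreover have "cinner (tens w) (tens []) = 0"
      using RW False by (intro cinner_tens_neq_length) auto
    ultimately show ?thesis
      using RW word by (simp add: level_proj_tens tens_Nil del: One_nat_def)
  qed
qed (simp_all add: bounded_clinear_simps[OF bounded_clinear_proj] cinner_simps scaleC_add_left
    scaleC_scaleC del: One_nat_def)

text \<open>Commutation with right tensoring is expressed through the relation
  \<open>shifted\<close>, so no operator for the tensoring has to be constructed on its closed
  domain.\<close>

definition shift_invariant :: "idx \<Rightarrow> ('h \<Rightarrow> 'h) set" where
  "shift_invariant \<iota> = {A. bounded_clinear A \<and>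
    (\<forall>k h g. letter_idx k = \<iota> \<longrightarrow> shifted k h g \<longrightarrow> shifted k (A h) (A g))}"

lemma shift_invariantI:
  assumes A: "bounded_clinear A"
    and word: "\<And>k w. letter_idx k = \<iota> \<Longrightarrow> w @ [k] \<in> RW \<Longrightarrow>
      shifted k (A (tens w)) (A (tens (w @ [k])))"
  shows "A \<in> shift_invariant \<iota>"
proof -
  have "shifted k (A h) (A g)" if "shifted k h g" "letter_idx k = \<iota>" for k h g
    using that(1) by induction (auto simp: bounded_clinear_simps[OF A] intro: word that(2) shifted.add shifted.scale)
  then show ?thesis
    using A by (simp add: shift_invariant_def)
qed

lemma shift_invariant_plus:
  "A \<in> shift_invariant \<iota> \<Longrightarrow> B \<in> shift_invariant \<iota> \<Longrightarrow> A + B \<in> shift_invariant \<iota>"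
  by (simp add: shift_invariant_def bounded_clinear_plus shifted.add)

lemma shift_invariant_scale:
  "A \<in> shift_invariant \<iota> \<Longrightarrow> (\<lambda>u. c *\<^sub>C A u) \<in> shift_invariant \<iota>"
  by (simp add: shift_invariant_def bounded_clinear_scale shifted.scale)

lemma shift_invariant_comp:
  "A \<in> shift_invariant \<iota> \<Longrightarrow> B \<in> shift_invariant \<iota> \<Longrightarrow> A \<circ> B \<in> shift_invariant \<iota>"
  unfolding shift_invariant_def by (simp add: bounded_clinear_comp)

text \<open>On \<open>\<xi>\<close> and on a letter \<open>k\<close> alike, compression to the first level only sees the component
  of \<open>A \<xi>\<close> along \<open>\<xi>\<close>.\<close>

lemma shift_invariant_compression:
  assumes A: "A \<in> shift_invariant \<iota>"
  shows "proj \<iota> (A (proj \<iota> u)) = \<phi> A *\<^sub>C proj \<iota> u"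
proof -
  have BL: "bounded_clinear A" using A by (simp add: shift_invariant_def)
  have sh: "shifted k (A \<xi>) (A (tens [k]))" if "letter_idx k = \<iota>" "centered k" for k
  proof -
    have "shifted k (tens []) (tens ([] @ [k]))"
      using that by (intro shifted.word) (simp add: Cons_RW)
    then show ?thesis
      using A that by (simp add: shift_invariant_def tens_Nil)
  qed
  have word: "proj \<iota> (A (tens w)) = \<phi> A *\<^sub>C tens w" if w: "bottom_word \<iota> w" "w \<in> RW" for w
  proof (cases "w = []")
    case True
    \<comment> \<open>Any centered letter of index \<open>\<iota>\<close> serves to reach the
      statement about \<open>\<xi>\<close>; expanding the vacuum letter supplies one.\<close>
    obtain c k where "letter_idx k = letter_idx (vacuum_letter \<iota>)" "centered k"
      "\<And>w. att (vacuum_letter \<iota>) w = c *\<^sub>C tens w + tens (k # w)"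
      by (rule attach_expand) (rule that)
    then have "proj \<iota> (A \<xi>) = \<phi> A *\<^sub>C \<xi>"
      using shifted_proj[OF sh[of k], of \<iota>] by (simp add: vacuum_state_def)
    then show ?thesis
      using True by (simp add: tens_Nil)
  next
    case False
    then obtain k where "w = [k]" "letter_idx k = \<iota>" "centered k"
      using w by (auto simp: bottom_word_def Cons_RW)
    then show ?thesis
      using shifted_proj[OF sh[of k], of \<iota>] by (simp add: vacuum_state_def)
  qed
  have "proj \<iota> \<circ> (A \<circ> proj \<iota>) = (\<lambda>u. \<phi> A *\<^sub>C proj \<iota> u)"
  proof (rule tens_eqI)
    fix w assume "w \<in> RW"
    then show "(proj \<iota> \<circ> (A \<circ> proj \<iota>)) (tens w) = \<phi> A *\<^sub>C proj \<iota> (tens w)"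
      using word by (simp add: level_proj_tens bounded_clinear_zero[OF BL]
          bounded_clinear_zero[OF bounded_clinear_proj] del: One_nat_def)
  qed (intro bounded_clinear_comp bounded_clinear_scale BL bounded_clinear_proj)+
  then show ?thesis
    by (metis o_apply)
qed

text \<open>As \<open>a\<close> lives in the corner of the projection, every element of its algebra
  adjacent to \<open>b'\<close> supplies a projection, and so does \<open>\<xi>\<close>. Thus
  \<open>b'\<close> is always compressed to a scalar.\<close>

lemma monotone_independentI:
  assumes a: "bounded_clinear a" "\<And>u. proj \<iota> (a u) = a u" "\<And>u. a (proj \<iota> u) = a u"
    and b: "bounded_clinear b"
    and compress: "\<And>b'. b' \<in> generated_algebra {b} \<Longrightarrow> \<exists>c. \<forall>u. proj \<iota> (b' (proj \<iota> u)) = c *\<^sub>C proj \<iota> u"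
  shows "monotone_independent \<phi> a b"
proof -
  have a1: "proj \<iota> (a1 u) = a1 u \<and> a1 (proj \<iota> u) = a1 u \<and> bounded_clinear a1"
    if "a1 \<in> generated_algebra {a}" for a1 u
    using that
    by (induction arbitrary: u) (simp_all add: a bounded_clinear_simps[OF bounded_clinear_proj]
      bounded_clinear_plus bounded_clinear_scale bounded_clinear_comp del: One_nat_def)
  have b': "bounded_clinear b'" if "b' \<in> generated_algebra {b}" for b'
    using generated_algebra_bounded_clinear[OF _ that] b by blast
  have w: "bounded_clinear w"
    if "w \<in> generated_algebra ({id} \<union> generated_algebra {a} \<union> generated_algebra {b})" for w
    by (rule generated_algebra_bounded_clinear[OF _ that]) (use a1 b' bounded_clinear_ident in blast)
  have compress': "proj \<iota> (b' (proj \<iota> u)) = \<phi> b' *\<^sub>C proj \<iota> u" if b': "b' \<in> generated_algebra {b}" for b' u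
  proof -
    obtain c where c: "\<And>u. proj \<iota> (b' (proj \<iota> u)) = c *\<^sub>C proj \<iota> u"
      using compress[OF b'] by blast
    \<comment> \<open>The vacuum lies in the range of the projection, so evaluation there identifies
      the unknown scalar as \<open>\<phi> b'\<close>.\<close>
    have "\<phi> b' = cinner (proj \<iota> (b' (proj \<iota> \<xi>))) \<xi>"
      by (simp add: vacuum_state_def positive_op_symmetric[OF positive_op_level_proj] proj_\<xi>
          del: One_nat_def)
    also have "\<dots> = c"
      unfolding c by (simp add: proj_\<xi> cinner_simps cinner_\<xi> del: One_nat_def)
    finally show ?thesis using c by simp
  qed
  have sandwich: "a1 (b' (proj \<iota> u)) = \<phi> b' *\<^sub>C a1 u"
    if "a1 \<in> generated_algebra {a}" "b' \<in> generated_algebra {b}" for a1 b' u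
  proof -
    have "a1 (b' (proj \<iota> u)) = a1 (proj \<iota> (b' (proj \<iota> u)))"
      using a1[OF that(1)] by metis
    also have "\<dots> = \<phi> b' *\<^sub>C a1 (proj \<iota> u)"
      using a1[OF that(1)] compress'[OF that(2)] by (metis bounded_clinear_scaleC)
    finally show ?thesis
      using a1[OF that(1)] by metis
  qed
  show ?thesis
    unfolding monotone_independent_def Let_def
  proof (intro ballI conjI)
    fix a1 a2 b' w1 w2
    assume A: "a1 \<in> generated_algebra {a}" "a2 \<in> generated_algebra {a}" "b' \<in> generated_algebra {b}"
      and W: "w1 \<in> generated_algebra ({id} \<union> generated_algebra {a} \<union> generated_algebra {b})"
        "w2 \<in> generated_algebra ({id} \<union> generated_algebra {a} \<union> generated_algebra {b})"
    show "\<phi> (w1 \<circ> a1 \<circ> b') = \<phi> b' * \<phi> (w1 \<circ> a1)"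
      using sandwich[OF A(1,3), of \<xi>]
      by (simp add: vacuum_state_def proj_\<xi> bounded_clinear_simps[OF w[OF W(1)]] cinner_simps
          del: One_nat_def)
    have "\<phi> (b' \<circ> a2 \<circ> w2) = cinner (b' (proj \<iota> (a2 (w2 \<xi>)))) (proj \<iota> \<xi>)"
      using a1[OF A(2)] by (simp add: vacuum_state_def proj_\<xi> del: One_nat_def)
    also have "\<dots> = cinner (proj \<iota> (b' (proj \<iota> (a2 (w2 \<xi>))))) \<xi>"
      by (simp add: positive_op_symmetric[OF positive_op_level_proj] del: One_nat_def)
    also have "\<dots> = \<phi> b' * \<phi> (a2 \<circ> w2)"
      unfolding compress'[OF A(3)] using a1[OF A(2)]
      by (simp add: vacuum_state_def cinner_simps del: One_nat_def)
    finally show "\<phi> (b' \<circ> a2 \<circ> w2) = \<phi> b' * \<phi> (a2 \<circ> w2)" .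
    have "a1 (b' (a2 u)) = \<phi> b' *\<^sub>C a1 (a2 u)" for u
      using sandwich[OF A(1,3), of "a2 u"] a1[OF A(2)] by metis
    then show "\<phi> (w1 \<circ> a1 \<circ> b' \<circ> a2 \<circ> w2) = \<phi> b' * \<phi> (w1 \<circ> a1 \<circ> a2 \<circ> w2)"
      by (simp add: vacuum_state_def bounded_clinear_simps[OF w[OF W(1)]] cinner_simps)
  qed
qed

end

context free_pair
begin

section \<open>The operators \<open>t\<close>, \<open>s\<close> and \<open>T\<close>\<close>

context
  fixes \<iota> :: idx and t s T :: "'c \<Rightarrow> 'c"
  assumes t: "t = id + ((proj \<iota> \<circ> X \<iota> \<circ> proj \<iota>) - proj \<iota>)"
    and s: "s = X \<iota> - ((proj \<iota> \<circ> X \<iota> \<circ> proj \<iota>) - proj \<iota>)"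
    and T: "T = op_sqrt s \<circ> X (bar \<iota>) \<circ> op_sqrt s"
begin

lemmas proj_simps = bounded_clinear_simps[OF bounded_clinear_proj[of \<iota>]]
  bounded_clinear_simps[OF bounded_clinear_X] proj_idem
  proj_commute[OF ampliated_X bounded_clinear_X, symmetric]

lemma t_apply: "t u = X \<iota> (proj \<iota> u) + (u - proj \<iota> u)"
  unfolding t by (simp add: proj_simps del: One_nat_def)

lemma s_apply: "s u = X \<iota> (u - proj \<iota> u) + proj \<iota> u"
  unfolding s by (simp add: proj_simps del: One_nat_def)

lemma cinner_proj_self: "cinner (proj \<iota> u) u = cinner (proj \<iota> u) (proj \<iota> u)"
  using positive_op_symmetric[OF positive_op_level_proj, of \<iota> "proj \<iota> u" u]
  by (simp add: proj_idem del: One_nat_def)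

lemma cinner_coproj: "cinner (u - proj \<iota> u) u = cinner (u - proj \<iota> u) (u - proj \<iota> u)"
  using cinner_proj_self[of u] positive_op_symmetric[OF positive_op_level_proj, of \<iota> u u]
  by (simp add: cinner_simps del: One_nat_def)

lemma cinner_X_proj: "cinner (X \<iota> (proj \<iota> u)) u = cinner (X \<iota> (proj \<iota> u)) (proj \<iota> u)"
  using positive_op_symmetric[OF positive_op_level_proj, of \<iota> "X \<iota> (proj \<iota> u)" u]
  by (simp add: proj_simps del: One_nat_def)

text \<open>The operator is block diagonal for the projection and its complement, so its form is the
  form of \<open>X \<iota>\<close> on one component plus the squared norm of the other.\<close>

lemma positive_op_t: "positive_op t"
proof (rule positive_opI)
  show "bounded_clinear t"
    unfolding t by (intro bounded_clinear_plus bounded_clinear_minus bounded_clinear_comp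
        bounded_clinear_ident bounded_clinear_proj bounded_clinear_X)
  show "cinner (t u) v = cinner u (t v)" for u v
    unfolding t by (simp add: cinner_simps positive_op_symmetric[OF positive_op_level_proj]
        positive_op_symmetric[OF positive_X] del: One_nat_def)
  show "Re (cinner (t u) u) \<ge> 0" for u
    unfolding t_apply cinner_add_left cinner_coproj cinner_X_proj
    using positive_op_Re[OF positive_X, of \<iota> "proj \<iota> u"] by (simp add: cinner_self del: One_nat_def)
qed

lemma positive_op_s: "positive_op s"
proof (rule positive_opI)
  show "bounded_clinear s"
    unfolding s by (intro bounded_clinear_minus bounded_clinear_comp
        bounded_clinear_proj bounded_clinear_X)
  show "cinner (s u) v = cinner u (s v)" for u v
    unfolding s by (simp add: cinner_simps positive_op_symmetric[OF positive_op_level_proj]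
        positive_op_symmetric[OF positive_X] del: One_nat_def)
  have "cinner (X \<iota> (u - proj \<iota> u)) u = cinner (X \<iota> (u - proj \<iota> u)) (u - proj \<iota> u)" for u
    using positive_op_symmetric[OF positive_op_level_proj, of \<iota> "X \<iota> (u - proj \<iota> u)" u]
    by (simp add: proj_simps cinner_simps del: One_nat_def)
  then show "Re (cinner (s u) u) \<ge> 0" for u
    unfolding s_apply cinner_add_left cinner_proj_self
    using positive_op_Re[OF positive_X, of \<iota> "u - proj \<iota> u"] by (simp add: cinner_self del: One_nat_def)
qed

lemma t_s: "t (s u) = X \<iota> u" and s_t: "s (t u) = X \<iota> u"
  unfolding t_apply s_apply by (simp_all add: proj_simps del: One_nat_def)

lemma sqrt_t_sqrt_s_commute: "op_sqrt t (op_sqrt s u) = op_sqrt s (op_sqrt t u)"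
proof (rule op_sqrt_commute[OF positive_op_t])
  show "bounded_clinear (op_sqrt s)"
    by (intro positive_op_bounded_clinear positive_op_sqrt positive_op_s)
  show "t (op_sqrt s u) = op_sqrt s (t u)" for u
    by (rule op_sqrt_commute[OF positive_op_s positive_op_bounded_clinear[OF positive_op_t], symmetric])
      (simp add: t_s s_t)
qed

lemma op_sqrt_X: "op_sqrt (X \<iota>) = op_sqrt t \<circ> op_sqrt s"
proof (rule op_sqrt_eqI[OF _ _ positive_X])
  show "positive_op (op_sqrt t \<circ> op_sqrt s)"
    by (intro positive_op_comp_commute positive_op_sqrt positive_op_t positive_op_s
        sqrt_t_sqrt_s_commute)
  have "op_sqrt t (op_sqrt s (op_sqrt t (op_sqrt s u))) =
      op_sqrt t (op_sqrt t (op_sqrt s (op_sqrt s u)))" for u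
    by (simp only: sqrt_t_sqrt_s_commute)
  then show "(op_sqrt t \<circ> op_sqrt s) ((op_sqrt t \<circ> op_sqrt s) u) = X \<iota> u" for u
    by (simp add: op_sqrt_square positive_op_t positive_op_s t_s)
qed

lemma distribution_eq:
  "distribution \<phi> (X (bar \<iota>) \<circ> X \<iota>) = distribution \<phi> (op_sqrt t \<circ> T \<circ> op_sqrt t)"
proof (rule distribution_cong)
  have "op_sqrt t \<circ> T \<circ> op_sqrt t = op_sqrt (X \<iota>) \<circ> X (bar \<iota>) \<circ> op_sqrt (X \<iota>)"
    by (rule ext) (simp add: T op_sqrt_X sqrt_t_sqrt_s_commute)
  then show "\<phi> ((X (bar \<iota>) \<circ> X \<iota>) ^^ n) = \<phi> ((op_sqrt t \<circ> T \<circ> op_sqrt t) ^^ n)" for n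
    by (simp only: moments_sqrt_conjugate)
qed

lemma sqrt_s_proj: "op_sqrt s (proj \<iota> u) = proj \<iota> u"
proof (rule op_sqrt_fixed[OF positive_op_s])
  show "s (proj \<iota> u) = proj \<iota> u"
    by (simp add: s_apply proj_simps del: One_nat_def)
qed

lemma proj_sqrt_s: "proj \<iota> (op_sqrt s u) = proj \<iota> u"
  by (rule cinner_eqI) (simp add: positive_op_symmetric[OF positive_op_level_proj]
      positive_op_symmetric[OF positive_op_sqrt[OF positive_op_s]] sqrt_s_proj del: One_nat_def)

lemma shift_invariant_X: "X (bar \<iota>) \<in> shift_invariant \<iota>"
  by (rule shift_invariantI[OF bounded_clinear_X]) (auto intro: shifted_ampliated[OF ampliated_X])

text \<open>At the empty word, both \<open>\<xi>\<close> and \<open>k\<close> are fixed by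
  \<open>s\<close>. At longer words neither vector meets the first level, \<open>s\<close> agrees
  with \<open>X \<iota>\<close> on both, and the exceptional case of
  \<open>shifted_ampliated\<close> does not arise.\<close>

lemma shift_invariant_s: "s \<in> shift_invariant \<iota>"
proof (rule shift_invariantI[OF positive_op_bounded_clinear[OF positive_op_s]])
  fix k w assume k: "letter_idx k = \<iota>" and wk: "w @ [k] \<in> RW"
  have P: "proj \<iota> (tens v) = (if bottom_word \<iota> v then tens v else 0)" if "v \<in> RW" for v
    by (rule level_proj_tens[OF that])
  show "shifted k (s (tens w)) (s (tens (w @ [k])))"
  proof (cases "w = []")
    case True
    then have "s (tens w) = tens w" "s (tens (w @ [k])) = tens (w @ [k])"
      using k wk P[of w] P[of "w @ [k]"]
      by (simp_all add: s_apply bottom_word_def bounded_clinear_zero[OF bounded_clinear_X]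
          del: One_nat_def)
    then show ?thesis
      using shifted.word[OF wk] by simp
  next
    case False
    then have "\<not> bottom_word \<iota> w" "\<not> bottom_word \<iota> (w @ [k])"
      using wk k by (auto simp: bottom_word_def snoc_RW)
    then have "s (tens w) = X \<iota> (tens w)" "s (tens (w @ [k])) = X \<iota> (tens (w @ [k]))"
      using wk P[of w] P[of "w @ [k]"] by (simp_all add: s_apply snoc_RW del: One_nat_def)
    then show ?thesis
      using shifted_ampliated[OF ampliated_X wk] False by simp
  qed
qed

text \<open>The roots stay outside \<open>B\<close> because membership in
  \<open>shift_invariant\<close> is available for \<open>s\<close>, not for its root. The scalar
  \<open>c\<close> accounts for the subtracted identity.\<close>

lemma T_algebra_form:
  assumes "b \<in> generated_algebra {T - id}"
  shows "\<exists>B\<in>shift_invariant \<iota>. \<exists>c. \<forall>u. b u = op_sqrt s (B (op_sqrt s u)) + c *\<^sub>C u"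
proof -
  note r = bounded_clinear_simps[OF positive_op_bounded_clinear[OF positive_op_sqrt[OF positive_op_s]]]
  show ?thesis
    using assms
  proof induction
    case (generator A)
    then show ?case
      by (intro bexI[OF _ shift_invariant_X] exI[of _ "- 1"]) (simp add: T)
  next
    case (scale A c)
    then obtain B d where B: "B \<in> shift_invariant \<iota>"
      "\<And>u. A u = op_sqrt s (B (op_sqrt s u)) + d *\<^sub>C u"
      by blast
    show ?case
      by (intro bexI[OF _ shift_invariant_scale[OF B(1), of c]] exI[of _ "c * d"])
        (simp add: B(2) r scaleC_add_right scaleC_scaleC)
  next
    case (add A A')
    then obtain B d B' d' where B: "B \<in> shift_invariant \<iota>" "B' \<in> shift_invariant \<iota>"
      "\<And>u. A u = op_sqrt s (B (op_sqrt s u)) + d *\<^sub>C u"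
      "\<And>u. A' u = op_sqrt s (B' (op_sqrt s u)) + d' *\<^sub>C u"
      by blast
    show ?case
      by (intro bexI[OF _ shift_invariant_plus[OF B(1,2)]] exI[of _ "d + d'"])
        (simp add: B(3,4) r scaleC_add_left)
  next
    case (comp A A')
    then obtain B d B' d' where B: "B \<in> shift_invariant \<iota>" "B' \<in> shift_invariant \<iota>"
      "\<And>u. A u = op_sqrt s (B (op_sqrt s u)) + d *\<^sub>C u"
      "\<And>u. A' u = op_sqrt s (B' (op_sqrt s u)) + d' *\<^sub>C u"
      by blast
    have "bounded_clinear B"
      using B(1) by (simp add: shift_invariant_def)
    note lin = bounded_clinear_simps[OF this] r
    \<comment> \<open>Expanding the product of the two forms, the inner roots meet to give
      \<open>s\<close> in \<open>B s B'\<close>, the mixed terms give \<open>d' B + d B'\<close>,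
      and the scalar is \<open>d d'\<close>.\<close>
    define D where "D = (B \<circ> (s \<circ> B')) + ((\<lambda>u. d' *\<^sub>C B u) + (\<lambda>u. d *\<^sub>C B' u))"
    have D: "D \<in> shift_invariant \<iota>"
      unfolding D_def by (intro shift_invariant_plus shift_invariant_comp shift_invariant_scale
          shift_invariant_s B)
    show ?case
      by (intro bexI[OF _ D] exI[of _ "d * d'"])
        (simp add: D_def B(3,4) lin op_sqrt_square[OF positive_op_s] scaleC_add_right scaleC_scaleC)
  qed
qed

lemma monotone_independent_t_T: "monotone_independent \<phi> (t - id) (T - id)"
proof (rule monotone_independentI[of _ \<iota>])
  have t': "t - id = (proj \<iota> \<circ> X \<iota> \<circ> proj \<iota>) - proj \<iota>"
    by (simp add: t)
  show "bounded_clinear (t - id)"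
    by (intro bounded_clinear_minus positive_op_bounded_clinear positive_op_t bounded_clinear_ident)
  show "proj \<iota> ((t - id) u) = (t - id) u" "(t - id) (proj \<iota> u) = (t - id) u" for u
    unfolding t' by (simp_all add: bounded_clinear_simps[OF bounded_clinear_proj] proj_idem
        del: One_nat_def)
  show "bounded_clinear (T - id)"
    unfolding T by (intro bounded_clinear_minus bounded_clinear_comp bounded_clinear_X
        bounded_clinear_ident positive_op_bounded_clinear positive_op_sqrt positive_op_s)
  fix b assume "b \<in> generated_algebra {T - id}"
  then obtain B c where B: "B \<in> shift_invariant \<iota>"
    "\<And>u. b u = op_sqrt s (B (op_sqrt s u)) + c *\<^sub>C u"
    using T_algebra_form by blast
  show "\<exists>d. \<forall>u. proj \<iota> (b (proj \<iota> u)) = d *\<^sub>C proj \<iota> u"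
  proof (intro exI allI)
    show "proj \<iota> (b (proj \<iota> u)) = (\<phi> B + c) *\<^sub>C proj \<iota> u" for u
      by (simp add: B(2) bounded_clinear_simps[OF bounded_clinear_proj] proj_sqrt_s sqrt_s_proj
          proj_idem shift_invariant_compression[OF B(1)] scaleC_add_left del: One_nat_def)
  qed
qed

end

end

theorem theorem7p1:
  fixes \<xi>1 :: "'a::complex_hilbert_space"
    and \<xi>2 :: "'b::complex_hilbert_space"
    and \<xi> :: "'h::complex_hilbert_space"
    and tens :: "('a + 'b) list \<Rightarrow> 'h"
    and x :: "'a \<Rightarrow> 'a"
    and y :: "'b \<Rightarrow> 'b"
    and P :: "idx \<Rightarrow> nat \<Rightarrow> 'h \<Rightarrow> 'h"
    and X :: "idx \<Rightarrow> 'h \<Rightarrow> 'h"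
    and Xc :: "idx \<Rightarrow> nat \<Rightarrow> 'h \<Rightarrow> 'h"
    and xc :: "idx \<Rightarrow> nat \<Rightarrow> 'h \<Rightarrow> 'h"
    and t :: "idx \<Rightarrow> 'h \<Rightarrow> 'h"
    and T :: "idx \<Rightarrow> 'h \<Rightarrow> 'h"
  assumes "norm \<xi>1 = 1" and "norm \<xi>2 = 1"
    and "is_free_product \<xi>1 \<xi>2 \<xi> tens"
    and "bounded_clinear x" and "bounded_clinear y"
    and "X I1 = free_rep1 \<xi>1 \<xi>2 tens x" and "X I2 = free_rep2 \<xi>1 \<xi>2 tens y"
    and "\<And>\<iota>. positive_op (X \<iota>)"
    and "P = level_proj \<xi>1 \<xi>2 tens"
    and "\<And>\<iota> j. Xc \<iota> j = P \<iota> j \<circ> X \<iota> \<circ> P \<iota> j"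
    and "\<And>\<iota> j. xc \<iota> j = Xc \<iota> j - P \<iota> j"
    and "\<And>\<iota>. t \<iota> = id + xc \<iota> 1"
    and "\<And>\<iota>. T (bar \<iota>) = op_sqrt (X \<iota> - xc \<iota> 1) \<circ> X (bar \<iota>) \<circ> op_sqrt (X \<iota> - xc \<iota> 1)"
  shows "\<forall>\<iota>.
    distribution (vacuum_state \<xi>) (X (bar \<iota>) \<circ> X \<iota>) =
      distribution (vacuum_state \<xi>) (op_sqrt (t \<iota>) \<circ> T (bar \<iota>) \<circ> op_sqrt (t \<iota>)) \<and>
    monotone_independent (vacuum_state \<xi>) (t \<iota> - id) (T (bar \<iota>) - id)"
proof
  fix \<iota>
  interpret free_product \<xi>1 \<xi>2 \<xi> tens
    by unfold_locales (fact assms)+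
  have ampl: "ampliated \<kappa> (X \<kappa>)" for \<kappa>
    using free_rep1_ampliated[OF assms(4)] free_rep2_ampliated[OF assms(5)] assms(6,7)
    by (cases \<kappa>) simp_all
  interpret free_pair \<xi>1 \<xi>2 \<xi> tens X
    by unfold_locales (fact assms(8), fact ampl)
  have xc: "xc \<iota> 1 = (proj \<iota> \<circ> X \<iota> \<circ> proj \<iota>) - proj \<iota>"
    by (simp only: assms(9,10,11))
  have t: "t \<iota> = id + ((proj \<iota> \<circ> X \<iota> \<circ> proj \<iota>) - proj \<iota>)"
    by (simp only: assms(12) xc)
  have T: "T (bar \<iota>) = op_sqrt (X \<iota> - ((proj \<iota> \<circ> X \<iota> \<circ> proj \<iota>) - proj \<iota>)) \<circ>
      X (bar \<iota>) \<circ> op_sqrt (X \<iota> - ((proj \<iota> \<circ> X \<iota> \<circ> proj \<iota>) - proj \<iota>))"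
    by (simp only: assms(13) xc)
  show "distribution (vacuum_state \<xi>) (X (bar \<iota>) \<circ> X \<iota>) =
      distribution (vacuum_state \<xi>) (op_sqrt (t \<iota>) \<circ> T (bar \<iota>) \<circ> op_sqrt (t \<iota>)) \<and>
    monotone_independent (vacuum_state \<xi>) (t \<iota> - id) (T (bar \<iota>) - id)"
    using distribution_eq[OF t refl T] monotone_independent_t_T[OF t refl T] by blast
qed

end
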